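(* Let $\beta\in(0,1)$ and let $(S_t)_{t\ge 0}$ be a $\beta$-stable subordinator. Let $X$ be a Feller process on a locally compact separable metric space $(M,\rho)$, independent of $S$, with transition probability density of the form $$p(t,x,y)=\frac{C_1}{t^{n/\alpha}}F\left(C_2\frac{\rho(x,y)}{t^{1/\alpha}}\right),\qquad t>0,\ x,y\in M,$$ where $n,\alpha,C_1,C_2>0$ are constants and $F:[0,\infty)\to(0,\infty)$ is a non-increasing profile function of exponential or polynomial type. Let $p^S(t,x,y)=\int_0^\infty p(s,x,y)\,\mathrm{d}_s\mathbb{P}(S_t\le s)$ be the transition density of the subordinate process $X_S=(X_{S_t})_{t\ge0}$. (a) If $\int_1^\infty s^{n+\alpha\beta-1}F(s)\,\mathrm{d}s<\infty$, then as $\rho(x,y)t^{-1/(\alpha\beta)}\to\infty$, $$p^S(t,x,y)\sim C_1\frac{\alpha\beta}{\Gamma(1-\beta)}\,C_2^{-n-\alpha\beta}\int_0^\infty s^{n+\alpha\beta-1}F(s)\,\mathrm{d}s\cdot\rho(x,y)^{-n-\alpha\beta}\,t.$$ (b) As $\rho(x,y)t^{-1/(\alpha\beta)}\to 0$, $$p^S(t,x,y)\sim C_1F(0+)\frac{\Gamma\left(\frac{n}{\alpha\beta}\right)}{\beta\,\Gamma\left(\frac n\alpha\right)}\,t^{-n/(\alpha\beta)}.$$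
   Context: A $\beta$-stable subordinator ($0<\beta<1$) is a non-decreasing Lévy process $S=(S_t)_{t\ge0}$ on $[0,\infty)$ with $\mathbb{E}\,e^{-rS_t}=e^{-tr^\beta}$ for $r>0$, $t\ge0$. The notation $\mathrm{d}_s\mathbb{P}(S_t\le s)$ means integration with respect to the law of $S_t$. Profile functions: $F$ is of exponential type if $F(r)=\exp[-r^{\alpha/(\alpha-1)}]$ with $\alpha\ge2$, and of polynomial type if $F(r)=(1+r^2)^{-(n+\alpha)/2}$ with $\alpha>0$; here $n,\alpha$ are the same constants as in the formula for $p$. $F(0+)=\lim_{r\downarrow0}F(r)$. Asymptotics: "$f(t,x,y)\sim g(t,x,y)$ as $A(t,x,y)\to\ell$" means that the ratio $f/g$ tends to $1$ as the quantity $A(t,x,y)$, with $t>0$ and $x,y\in M$, tends to $\ell$ (so the convergence depends on $(t,x,y)$ only through $A$). *)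

theory Defs
  imports "HOL-Probability.Probability" "HOL-Library.Landau_Symbols"
begin

text \<open>Processes are indexed by real numbers, of which only the times \<open>t \<ge> 0\<close> matter. No regularity
  of the sample paths is imposed beyond stochastic continuity for Levy processes and the Feller
  property below, so that in particular all cadlag versions are covered.\<close>

definition levy_process :: "'w measure \<Rightarrow> (real \<Rightarrow> 'w \<Rightarrow> real) \<Rightarrow> bool" where
  "levy_process P S \<longleftrightarrow>
     prob_space P \<and>
     (\<forall>t\<ge>0. S t \<in> borel_measurable P) \<and>
     (AE \<omega> in P. S 0 \<omega> = 0) \<and>
     (\<forall>\<tau>. mono \<tau> \<and> 0 \<le> \<tau> 0 \<longrightarrow>
        prob_space.indep_vars P (\<lambda>_. borel)
          (\<lambda>i \<omega>. S (\<tau> (Suc i)) \<omega> - S (\<tau> i) \<omega>) (UNIV :: nat set)) \<and>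
     (\<forall>s t. 0 \<le> s \<and> s \<le> t \<longrightarrow>
        distr P borel (\<lambda>\<omega>. S t \<omega> - S s \<omega>) = distr P borel (S (t - s))) \<and>
     (\<forall>t\<ge>0. \<forall>\<epsilon>>0.
        ((\<lambda>s. measure P {\<omega> \<in> space P. \<epsilon> < \<bar>S s \<omega> - S t \<omega>\<bar>}) \<longlongrightarrow> 0) (at t within {0..}))"

text \<open>Together with \<open>S\<^sub>0 = 0\<close>, monotonicity of the paths makes \<open>S\<close> take values in \<open>[0,\<infinity>)\<close>.\<close>

definition stable_subordinator :: "real \<Rightarrow> 'w measure \<Rightarrow> (real \<Rightarrow> 'w \<Rightarrow> real) \<Rightarrow> bool" where
  "stable_subordinator \<beta> P S \<longleftrightarrow>
     0 < \<beta> \<and> \<beta> < 1 \<and>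
     levy_process P S \<and>
     (AE \<omega> in P. \<forall>s t. 0 \<le> s \<and> s \<le> t \<longrightarrow> S s \<omega> \<le> S t \<omega>) \<and>
     (\<forall>r>0. \<forall>t\<ge>0. (\<integral>\<omega>. exp (- r * S t \<omega>) \<partial>P) = exp (- t * r powr \<beta>))"

definition vanishing_at_infinity :: "('m::topological_space \<Rightarrow> real) set" where
  "vanishing_at_infinity =
     {u. continuous_on UNIV u \<and> (\<forall>\<epsilon>>0. \<exists>K. compact K \<and> (\<forall>x. x \<notin> K \<longrightarrow> \<bar>u x\<bar> < \<epsilon>))}"

text \<open>The \<open>\<sigma>\<close>-algebra on \<open>\<Omega>\<close> generated by the random variables \<open>X s\<close> with \<open>s \<in> T\<close>.\<close>

definition generated_algebra ::
    "'w set \<Rightarrow> (real \<Rightarrow> 'w \<Rightarrow> 'a::topological_space) \<Rightarrow> real set \<Rightarrow> 'w measure" where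
  "generated_algebra \<Omega> X T =
     vimage_algebra \<Omega> (\<lambda>\<omega>. \<lambda>s\<in>T. X s \<omega>) (PiM T (\<lambda>_. borel))"

text \<open>A time-homogeneous Markov process is given by one family of random variables \<open>X t\<close> on a
  measurable space \<open>N\<close> (only the space and the measurable sets of \<open>N\<close> are relevant) and
  probability measures \<open>P x\<close>, under which the process starts at \<open>x\<close>.\<close>

definition markov_process ::
    "'w measure \<Rightarrow> ('m::topological_space \<Rightarrow> 'w measure) \<Rightarrow> (real \<Rightarrow> 'w \<Rightarrow> 'm) \<Rightarrow> bool" where
  "markov_process N P X \<longleftrightarrow>
     (\<forall>x. prob_space (P x) \<and> sets (P x) = sets N) \<and>
     (\<forall>t\<ge>0. X t \<in> measurable N borel) \<and>
     (\<forall>x. AE \<omega> in P x. X 0 \<omega> = x) \<and>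
     (\<forall>t\<ge>0. (\<lambda>x. distr (P x) borel (X t)) \<in> measurable borel (prob_algebra borel)) \<and>
     (\<forall>x. \<forall>s\<ge>0. \<forall>t\<ge>0. \<forall>B\<in>sets borel.
        AE \<omega> in P x.
          real_cond_exp (P x) (generated_algebra (space N) X {0..s}) (\<lambda>\<omega>'. indicator B (X (s + t) \<omega>')) \<omega> =
          measure (distr (P (X s \<omega>)) borel (X t)) B)"

definition feller_process ::
    "'w measure \<Rightarrow> ('m::topological_space \<Rightarrow> 'w measure) \<Rightarrow> (real \<Rightarrow> 'w \<Rightarrow> 'm) \<Rightarrow> bool" where
  "feller_process N P X \<longleftrightarrow>
     markov_process N P X \<and>
     (\<forall>u\<in>vanishing_at_infinity.
        (\<forall>t\<ge>0. (\<lambda>x. \<integral>\<omega>. u (X t \<omega>) \<partial>P x) \<in> vanishing_at_infinity) \<and>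
        uniform_limit UNIV (\<lambda>t x. \<integral>\<omega>. u (X t \<omega>) \<partial>P x) u (at_right 0))"

definition independent_processes ::
    "'w measure \<Rightarrow> (real \<Rightarrow> 'w \<Rightarrow> 'a::topological_space) \<Rightarrow> (real \<Rightarrow> 'w \<Rightarrow> 'b::topological_space) \<Rightarrow> bool" where
  "independent_processes P X Y \<longleftrightarrow>
     prob_space.indep_set P
       (sets (generated_algebra (space P) X {0..}))
       (sets (generated_algebra (space P) Y {0..}))"

definition transition_density ::
    "('m::topological_space \<Rightarrow> 'w measure) \<Rightarrow> (real \<Rightarrow> 'w \<Rightarrow> 'm) \<Rightarrow> 'm measure \<Rightarrow>
     (real \<Rightarrow> 'm \<Rightarrow> 'm \<Rightarrow> real) \<Rightarrow> bool" where
  "transition_density P X \<mu> p \<longleftrightarrow>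
     (\<forall>t>0. \<forall>x. (\<forall>y. 0 \<le> p t x y) \<and> distributed (P x) \<mu> (X t) (\<lambda>y. ennreal (p t x y)))"

definition exponential_type :: "real \<Rightarrow> (real \<Rightarrow> real) \<Rightarrow> bool" where
  "exponential_type \<alpha> F \<longleftrightarrow> 2 \<le> \<alpha> \<and> (\<forall>r\<ge>0. F r = exp (- (r powr (\<alpha> / (\<alpha> - 1)))))"

definition polynomial_type :: "real \<Rightarrow> real \<Rightarrow> (real \<Rightarrow> real) \<Rightarrow> bool" where
  "polynomial_type n \<alpha> F \<longleftrightarrow> 0 < \<alpha> \<and> (\<forall>r\<ge>0. F r = (1 + r\<^sup>2) powr (- (n + \<alpha>) / 2))"

definition profile_density ::
    "real \<Rightarrow> real \<Rightarrow> real \<Rightarrow> real \<Rightarrow> (real \<Rightarrow> real) \<Rightarrow> real \<Rightarrow> 'm::metric_space \<Rightarrow> 'm \<Rightarrow> real" where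
  "profile_density C\<^sub>1 C\<^sub>2 n \<alpha> F t x y =
     C\<^sub>1 / t powr (n / \<alpha>) * F (C\<^sub>2 * (dist x y / t powr (1 / \<alpha>)))"

text \<open>The law of \<open>S t\<close> is taken under \<open>P x\<close>; if \<open>S\<close> is a stable subordinator under every \<open>P x\<close>, this
  law does not depend on \<open>x\<close>. The point \<open>s = 0\<close>, where \<open>p\<close> is not meaningful, is left out of the
  domain of integration; it is a null set for the law of \<open>S t\<close> when \<open>t > 0\<close>.\<close>

definition subordinate_density ::
    "('m \<Rightarrow> 'w measure) \<Rightarrow> (real \<Rightarrow> 'w \<Rightarrow> real) \<Rightarrow> (real \<Rightarrow> 'm \<Rightarrow> 'm \<Rightarrow> real) \<Rightarrow>
     real \<Rightarrow> 'm \<Rightarrow> 'm \<Rightarrow> real" where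
  "subordinate_density P S p t x y = (LINT s:{0<..}|distr (P x) borel (S t). p s x y)"

text \<open>The filter on triples \<open>(t, x, y)\<close> with \<open>t > 0\<close> that expresses
  \<open>A (t, x, y) \<rightarrow> \<l>\<close> when \<open>L\<close> is the filter of neighbourhoods of \<open>\<l>\<close>
  (\<open>at_top\<close> for \<open>\<l> = \<infinity>\<close>). Limits along it are uniform over all triples with \<open>A\<close> close to \<open>\<l>\<close>.\<close>

definition regime :: "(real \<times> 'm \<times> 'm \<Rightarrow> real) \<Rightarrow> real filter \<Rightarrow> (real \<times> 'm \<times> 'm) filter" where
  "regime A L = inf (filtercomap A L) (principal {(t, x, y). 0 < t})"

end

theory Submission
  imports Defs "HOL-Real_Asymp.Real_Asymp"
begin

text \<open>
  After rescaling by \<open>c = (dist x y) powr \<alpha>\<close> in (a) and by \<open>c = t powr (1 / \<beta>)\<close> in (b), the density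
  is an expectation of a fixed function of \<open>V = S t / c\<close>, and \<open>V\<close> has Laplace transform
  \<open>exp (- \<epsilon> * r powr \<beta>)\<close> with \<open>\<epsilon> = t * c powr (- \<beta>)\<close>.

  In (a), \<open>\<epsilon>\<close> tends to \<open>0\<close>. The measures \<open>(1 - exp (- u)) / \<epsilon>\<close> times the law of \<open>V\<close> have Laplace
  transforms converging to \<open>(r + 1) powr \<beta> - r powr \<beta>\<close>, which is the transform of
  \<open>1 - exp (- u)\<close> times the Levy measure. With \<open>z = exp (- u)\<close> and the
  Weierstrass theorem on \<open>[0,1]\<close> they converge against every continuous function on \<open>[0,\<infinity>]\<close>.
  The function \<open>u powr (- (n / \<alpha>)) * F (C\<^sub>2 * u powr (- (1 / \<alpha>)))\<close>, divided by \<open>1 - exp (- u)\<close>, is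
  such a function because \<open>r powr (n + \<alpha>) * F r\<close> converges at infinity for both profile types.

  In (b), \<open>\<epsilon> = 1\<close>, and \<open>1 - F r \<le> K * r\<close> bounds the error by a multiple of a negative moment
  of \<open>V\<close>; negative moments are Mellin transforms of the Laplace transform.
\<close>

section \<open>Power substitutions and Gamma integrals\<close>

text \<open>The substitution \<open>s = c * u powr a\<close> is a bijection of the open half-line
  onto itself. It is decreasing for \<open>a < 0\<close>, a case met later with
  \<open>a = - (1 / \<alpha>)\<close>, hence the absolute value in the Jacobian. If one side is not
  integrable, neither is the other, and both integrals take the default value 0.\<close>

lemma powr_substitution:
  fixes f :: "real \<Rightarrow> real" and a c :: real
  assumes f [measurable]: "f \<in> borel_measurable borel" and a: "a \<noteq> 0" and c: "0 < c"
  shows "set_integrable lborel {0<..} (\<lambda>u. \<bar>a\<bar> * c * u powr (a - 1) * f (c * u powr a))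
           \<longleftrightarrow> set_integrable lborel {0<..} f" (is "?int")
    and "(LBINT u:{0<..}. \<bar>a\<bar> * c * u powr (a - 1) * f (c * u powr a)) = (LBINT s:{0<..}. f s)" (is ?eq)
proof -
  define g where "g = (\<lambda>u::real. c * u powr a)"
  define g' where "g' = (\<lambda>u::real. a * c * u powr (a - 1))"
  let ?h = "\<lambda>u. \<bar>a\<bar> * c * u powr (a - 1) * f (c * u powr a)"
  have der: "(g has_field_derivative g' u) (at u within {0<..})" if "u \<in> {0<..}" for u
    unfolding g_def g'_def using that by (auto intro!: derivative_eq_intros)
  have inj: "inj_on g {0<..}"
  proof (rule inj_onI)
    fix x y assume "x \<in> {0<..}" "y \<in> {0<..}" "g x = g y"
    then have "(x powr a) powr (1 / a) = (y powr a) powr (1 / a)" "0 < x" "0 < y"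
      using c by (simp_all add: g_def)
    with a show "x = y" by (simp add: powr_powr)
  qed
  have "s \<in> g ` {0<..}" if "0 < s" for s
  proof
    show "s = g ((s / c) powr (1 / a))"
      using that a c by (simp add: g_def powr_powr)
  qed (use that c in auto)
  then have img: "g ` {0<..} = {0<..}"
    using c by (auto simp: g_def)
  have h: "(\<lambda>u. \<bar>g' u\<bar> * f (g u)) = ?h"
    using c by (auto simp: g_def g'_def abs_mult)
  \<comment> \<open>The value \<open>b\<close> stays free: choosing it as either integral yields the
    transfer of integrability in both directions as well as the equality of the values.\<close>
  have cov: "(?h absolutely_integrable_on {0<..} \<and> integral {0<..} ?h = b) \<longleftrightarrow>
        (f absolutely_integrable_on {0<..} \<and> integral {0<..} f = b)" for b
    using has_absolute_integral_change_of_variables_1'[OF _ der inj, of f b] by (simp add: h img)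
  \<comment> \<open>The change of variables speaks of the completed Lebesgue measure; for Borel
    functions integrability and integral agree with those for \<open>lborel\<close>.\<close>
  have lebesgue: "set_integrable lebesgue {0<..} k \<longleftrightarrow> set_integrable lborel {0<..} k"
      "set_lebesgue_integral lebesgue {0<..} k = set_lebesgue_integral lborel {0<..} k"
    if [measurable]: "k \<in> borel_measurable borel" for k :: "real \<Rightarrow> real"
    by (simp_all add: set_integrable_def set_lebesgue_integral_def integrable_completion integral_completion)
  have [measurable]: "?h \<in> borel_measurable borel"
    by measurable
  show int: ?int
    using cov lebesgue(1)[of ?h] lebesgue(1)[of f] by auto
  show ?eq
  proof (cases "set_integrable lborel {0<..} f")
    case True
    then have "f absolutely_integrable_on {0<..}"
      using lebesgue(1)[of f] by simp
    with cov[of "integral {0<..} f"]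
    have "?h absolutely_integrable_on {0<..}" "integral {0<..} ?h = integral {0<..} f"
      by auto
    with \<open>f absolutely_integrable_on {0<..}\<close> show ?thesis
      using lebesgue(2)[of ?h] lebesgue(2)[of f] by (simp add: set_lebesgue_integral_eq_integral(2))
  next
    case False
    with int show ?thesis
      by (simp add: set_integrable_def set_lebesgue_integral_def not_integrable_integral_eq)
  qed
qed

text \<open>The substitution \<open>s = c * u powr b\<close> turns the integral into Euler's
  integral for \<open>Gamma (\<gamma> / b)\<close>. With \<open>b = 1\<close> it represents a
  negative power of \<open>c\<close>; with \<open>b = \<beta>\<close> and \<open>c = 1\<close> it is
  the Mellin transform of the stable Laplace transform.\<close>

lemma gamma_powr_integral:
  fixes \<gamma> b c :: real
  assumes "0 < \<gamma>" "0 < b" "0 < c"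
  shows "set_integrable lborel {0<..} (\<lambda>u. u powr (\<gamma> - 1) * exp (- (c * u powr b)))"
    and "(LBINT u:{0<..}. u powr (\<gamma> - 1) * exp (- (c * u powr b))) = Gamma (\<gamma> / b) / (b * c powr (\<gamma> / b))"
proof -
  let ?f = "\<lambda>s::real. s powr (\<gamma> / b - 1) * exp (- s)"
  have pos: "0 < \<gamma> / b" using assms by simp
  have "(\<integral>\<^sup>+s. ennreal (indicator {0<..} s * ?f s) \<partial>lborel) = ennreal (Gamma (\<gamma> / b))"
    unfolding Gamma_conv_nn_integral_real[OF pos]
    by (intro nn_integral_cong) (auto simp: indicator_def exp_minus field_simps)
  then have "has_bochner_integral lborel (\<lambda>s. indicator {0<..} s * ?f s) (Gamma (\<gamma> / b))"
    using pos by (intro has_bochner_integral_nn_integral) (auto simp: indicator_def Gamma_real_pos less_imp_le)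
  then have f: "set_integrable lborel {0<..} ?f" "(LBINT s:{0<..}. ?f s) = Gamma (\<gamma> / b)"
    by (auto simp: set_integrable_def set_lebesgue_integral_def has_bochner_integral_iff)
  define K where "K = b * c powr (\<gamma> / b)"
  have K: "0 < K" using assms by (simp add: K_def)
  have eq: "\<bar>b\<bar> * c * u powr (b - 1) * ?f (c * u powr b) =
      K * (u powr (\<gamma> - 1) * exp (- (c * u powr b)))" if "0 < u" for u
  proof -
    have "(c * u powr b) powr (\<gamma> / b - 1) = c powr (\<gamma> / b - 1) * u powr (\<gamma> - b)"
      using assms that by (simp add: powr_mult powr_powr right_diff_distrib)
    moreover have "c * c powr (\<gamma> / b - 1) = c powr (\<gamma> / b)"
      using assms by (simp add: powr_diff)
    moreover have "u powr (b - 1) * u powr (\<gamma> - b) = u powr (\<gamma> - 1)"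
      by (simp flip: powr_add)
    ultimately show ?thesis
      using assms by (simp add: K_def) (metis (no_types, opaque_lifting) mult.assoc mult.left_commute)
  qed
  have m: "?f \<in> borel_measurable borel" by measurable
  have "set_integrable lborel {0<..} (\<lambda>u. \<bar>b\<bar> * c * u powr (b - 1) * ?f (c * u powr b))"
    using powr_substitution(1)[OF m, of b c] assms f by blast
  then have "set_integrable lborel {0<..} (\<lambda>u. K * (u powr (\<gamma> - 1) * exp (- (c * u powr b))))"
    by (subst (asm) set_integrable_cong[OF refl refl eq]) auto
  with K show "set_integrable lborel {0<..} (\<lambda>u. u powr (\<gamma> - 1) * exp (- (c * u powr b)))"
    by (subst (asm) set_integrable_mult_right_iff) auto
  have "(LBINT u:{0<..}. \<bar>b\<bar> * c * u powr (b - 1) * ?f (c * u powr b)) = Gamma (\<gamma> / b)"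
    using powr_substitution(2)[OF m, of b c] assms f by simp
  also have "(LBINT u:{0<..}. \<bar>b\<bar> * c * u powr (b - 1) * ?f (c * u powr b)) =
      (LBINT u:{0<..}. K * (u powr (\<gamma> - 1) * exp (- (c * u powr b))))"
    by (intro set_lebesgue_integral_cong allI impI eq) auto
  finally have "K * (LBINT u:{0<..}. u powr (\<gamma> - 1) * exp (- (c * u powr b))) = Gamma (\<gamma> / b)"
    by simp
  with K show "(LBINT u:{0<..}. u powr (\<gamma> - 1) * exp (- (c * u powr b))) = Gamma (\<gamma> / b) / (b * c powr (\<gamma> / b))"
    unfolding K_def[symmetric] by (simp add: field_simps)
qed

lemma nn_gamma_powr_integral:
  fixes \<gamma> b c :: real
  assumes "0 < \<gamma>" "0 < b" "0 < c"
  shows "(\<integral>\<^sup>+u. ennreal (indicator {0<..} u * (u powr (\<gamma> - 1) * exp (- (c * u powr b)))) \<partial>lborel) =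
      ennreal (Gamma (\<gamma> / b) / (b * c powr (\<gamma> / b)))"
  using gamma_powr_integral[OF assms]
  by (subst nn_integral_eq_integral)
    (auto simp: set_integrable_def set_lebesgue_integral_def)

text \<open>Tonelli, after writing \<open>(1 - exp (- u)) * exp (- (x * u))\<close> as \<open>u\<close> times the integral of
  \<open>exp (- (v * u))\<close> over \<open>v\<close> between \<open>x\<close> and \<open>x + 1\<close>.\<close>

lemma levy_moment_integral:
  fixes \<beta> x :: real
  assumes \<beta>: "0 < \<beta>" "\<beta> < 1" and x: "0 \<le> x"
  defines "w \<equiv> \<lambda>u. (1 - exp (- u)) * u powr (- 1 - \<beta>)"
  shows "set_integrable lborel {0<..} (\<lambda>u. w u * exp (- (x * u)))"
    and "(LBINT u:{0<..}. w u * exp (- (x * u))) = Gamma (1 - \<beta>) / \<beta> * ((x + 1) powr \<beta> - x powr \<beta>)"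
proof -
  let ?I = "{x..x + 1}"
  let ?C = "Gamma (1 - \<beta>) / \<beta> * ((x + 1) powr \<beta> - x powr \<beta>)"
  have \<Gamma>: "0 < Gamma (1 - \<beta>)" using \<beta> by (simp add: Gamma_real_pos)
  have inner: "ennreal (indicator {0<..} u * (w u * exp (- (x * u)))) =
      (\<integral>\<^sup>+v. ennreal (indicator {0<..} u * indicator ?I v * (u powr (- \<beta>) * exp (- (v * u)))) \<partial>lborel)" for u
  proof (cases "0 < u")
    case True
    have "((\<lambda>v. u powr (- \<beta>) * exp (- (v * u))) has_integral
        (- (u powr (- 1 - \<beta>) * exp (- ((x + 1) * u))) - - (u powr (- 1 - \<beta>) * exp (- (x * u))))) ?I"
      using True by (intro fundamental_theorem_of_calculus)
        (auto intro!: derivative_eq_intros simp: has_real_derivative_iff_has_vector_derivative[symmetric] powr_diff powr_minus field_simps)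
    also have "(- (u powr (- 1 - \<beta>) * exp (- ((x + 1) * u))) - - (u powr (- 1 - \<beta>) * exp (- (x * u)))) =
        w u * exp (- (x * u))"
      by (simp add: w_def algebra_simps exp_diff exp_add exp_minus divide_inverse)
    finally have "(\<integral>\<^sup>+v. ennreal (indicator ?I v * (u powr (- \<beta>) * exp (- (v * u)))) \<partial>lborel) =
        ennreal (w u * exp (- (x * u)))"
      by (intro nn_integral_has_integral_lebesgue) auto
    with True show ?thesis by simp
  qed simp
  \<comment> \<open>For \<open>x = 0\<close> the interval contains \<open>v = 0\<close>, where the
    left side is infinite while \<open>0 powr (\<beta> - 1) = 0\<close> makes the right side vanish.
    This single point is excluded here and discarded below as a null set.\<close>
  have outer: "(\<integral>\<^sup>+u. ennreal (indicator {0<..} u * indicator ?I v * (u powr (- \<beta>) * exp (- (v * u)))) \<partial>lborel) =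
      ennreal (indicator ?I v * (Gamma (1 - \<beta>) * v powr (\<beta> - 1)))" if "v \<noteq> 0" for v
  proof (cases "v \<in> ?I")
    case True
    with that x have "0 < v" by auto
    then show ?thesis
      using nn_gamma_powr_integral[of "1 - \<beta>" 1 v] True \<beta>
      by (auto simp: powr_minus powr_diff field_simps indicator_def cong: if_cong intro!: nn_integral_cong elim!: back_subst[of "\<lambda>y. y = _"])
  qed simp
  \<comment> \<open>For \<open>x = 0\<close> the antiderivative is continuous but not differentiable
    at the left end point, so the fundamental theorem is applied in its interior form.\<close>
  have "((\<lambda>v. v powr (\<beta> - 1)) has_integral ((x + 1) powr \<beta> / \<beta> - x powr \<beta> / \<beta>)) ?I"
    using x \<beta> by (intro fundamental_theorem_of_calculus_interior)
        (auto intro!: continuous_intros continuous_on_powr' derivative_eq_intros simp: has_real_derivative_iff_has_vector_derivative[symmetric])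
  from has_integral_mult_right[OF this, of "Gamma (1 - \<beta>)"]
  have C: "(\<integral>\<^sup>+v. ennreal (indicator ?I v * (Gamma (1 - \<beta>) * v powr (\<beta> - 1))) \<partial>lborel) = ennreal ?C"
    using \<Gamma> by (intro nn_integral_has_integral_lebesgue) (auto simp: right_diff_distrib)
  have "(\<integral>\<^sup>+u. ennreal (indicator {0<..} u * (w u * exp (- (x * u)))) \<partial>lborel) =
      (\<integral>\<^sup>+u. \<integral>\<^sup>+v. ennreal (indicator {0<..} u * indicator ?I v * (u powr (- \<beta>) * exp (- (v * u)))) \<partial>lborel \<partial>lborel)"
    by (simp only: inner)
  also have "\<dots> = (\<integral>\<^sup>+v. \<integral>\<^sup>+u. ennreal (indicator {0<..} u * indicator ?I v * (u powr (- \<beta>) * exp (- (v * u)))) \<partial>lborel \<partial>lborel)"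
    by (rule lborel_pair.Fubini') measurable
  also have "\<dots> = (\<integral>\<^sup>+v. ennreal (indicator ?I v * (Gamma (1 - \<beta>) * v powr (\<beta> - 1))) \<partial>lborel)"
    by (rule nn_integral_cong_AE) (use AE_lborel_singleton[of 0] outer in \<open>auto elim!: eventually_mono\<close>)
  finally have nn: "(\<integral>\<^sup>+u. ennreal (indicator {0<..} u * (w u * exp (- (x * u)))) \<partial>lborel) = ennreal ?C"
    by (simp only: C)
  have "x powr \<beta> \<le> (x + 1) powr \<beta>"
    using x \<beta> by (intro powr_mono2) auto
  then have "0 \<le> ?C" using \<beta> \<Gamma> by simp
  then have "has_bochner_integral lborel (\<lambda>u. indicator {0<..} u * (w u * exp (- (x * u)))) ?C"
    by (intro has_bochner_integral_nn_integral nn) (auto simp: w_def indicator_def)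
  then show "set_integrable lborel {0<..} (\<lambda>u. w u * exp (- (x * u)))"
    and "(LBINT u:{0<..}. w u * exp (- (x * u))) = ?C"
    by (auto simp: set_integrable_def set_lebesgue_integral_def has_bochner_integral_iff)
qed

section \<open>Limits from Laplace transforms\<close>

text \<open>\<open>Gamma \<gamma> * V powr (- \<gamma>)\<close> is the integral of \<open>r powr (\<gamma> - 1) * exp (- (r * V))\<close> over
  \<open>r > 0\<close>; for \<open>V = 0\<close> that integral is infinite although \<open>0 powr (- \<gamma>) = 0\<close>.\<close>

lemma negative_moment:
  fixes V :: "'w \<Rightarrow> real" and \<beta> \<gamma> :: real
  assumes "prob_space M" and V [measurable]: "V \<in> borel_measurable M"
    and nonneg: "AE \<omega> in M. 0 \<le> V \<omega>"
    and laplace: "\<And>r. 0 < r \<Longrightarrow> (\<integral>\<omega>. exp (- (r * V \<omega>)) \<partial>M) = exp (- (r powr \<beta>))"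
    and \<beta>: "0 < \<beta>" and \<gamma>: "0 < \<gamma>"
  shows "AE \<omega> in M. 0 < V \<omega>"
    and "integrable M (\<lambda>\<omega>. V \<omega> powr (- \<gamma>))"
    and "(\<integral>\<omega>. V \<omega> powr (- \<gamma>) \<partial>M) = Gamma (\<gamma> / \<beta>) / (\<beta> * Gamma \<gamma>)"
proof -
  interpret prob_space M by fact
  interpret pair_sigma_finite M lborel ..
  have \<Gamma>: "0 < Gamma \<gamma>" using \<gamma> by (simp add: Gamma_real_pos)
  have \<Gamma>': "0 < Gamma (\<gamma> / \<beta>)" using \<gamma> \<beta> by (simp add: Gamma_real_pos)
  let ?f = "\<lambda>\<omega> r. ennreal (indicator {0<..} r * (r powr (\<gamma> - 1) * exp (- (r * V \<omega>))))"
  have "(\<integral>\<^sup>+\<omega>. \<integral>\<^sup>+r. ?f \<omega> r \<partial>lborel \<partial>M) = (\<integral>\<^sup>+r. \<integral>\<^sup>+\<omega>. ?f \<omega> r \<partial>M \<partial>lborel)"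
    by (rule Fubini'[symmetric]) measurable
  also have "\<dots> = (\<integral>\<^sup>+r. ennreal (indicator {0<..} r * (r powr (\<gamma> - 1) * exp (- (1 * r powr \<beta>)))) \<partial>lborel)"
  proof (intro nn_integral_cong)
    fix r :: real
    show "(\<integral>\<^sup>+\<omega>. ?f \<omega> r \<partial>M) = ennreal (indicator {0<..} r * (r powr (\<gamma> - 1) * exp (- (1 * r powr \<beta>))))"
    proof (cases "0 < r")
      case True
      have "integrable M (\<lambda>\<omega>. exp (- (r * V \<omega>)))"
        using nonneg True by (intro integrable_const_bound[of _ 1]) auto
      then have "(\<integral>\<^sup>+\<omega>. ennreal (exp (- (r * V \<omega>))) \<partial>M) = ennreal (exp (- (r powr \<beta>)))"
        by (subst nn_integral_eq_integral) (use True in \<open>auto simp: laplace\<close>)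
      with True show ?thesis
        by (simp add: ennreal_mult' nn_integral_cmult)
    qed simp
  qed
  also have "\<dots> = ennreal (Gamma (\<gamma> / \<beta>) / \<beta>)"
    using nn_gamma_powr_integral[OF \<gamma> \<beta>, of 1] by simp
  finally have total: "(\<integral>\<^sup>+\<omega>. \<integral>\<^sup>+r. ?f \<omega> r \<partial>lborel \<partial>M) = ennreal (Gamma (\<gamma> / \<beta>) / \<beta>)" .
  have inner: "(\<integral>\<^sup>+r. ?f \<omega> r \<partial>lborel) = ennreal (Gamma \<gamma> * V \<omega> powr (- \<gamma>))" if "0 < V \<omega>" for \<omega>
    using nn_gamma_powr_integral[of \<gamma> 1 "V \<omega>"] that \<gamma>
    by (auto simp: powr_minus divide_inverse mult_ac intro!: nn_integral_cong elim!: back_subst[of "\<lambda>y. y = _"])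
  \<comment> \<open>Inserting a factor \<open>exp (- (c * r))\<close> only decreases the integral,
    so it dominates \<open>Gamma \<gamma> * c powr (- \<gamma>)\<close> for every
    \<open>c > 0\<close>, which is unbounded as \<open>c\<close> tends to 0.\<close>
  have at_zero: "(\<integral>\<^sup>+r. ?f \<omega> r \<partial>lborel) = \<infinity>" if "V \<omega> = 0" for \<omega>
  proof (rule ccontr)
    assume "(\<integral>\<^sup>+r. ?f \<omega> r \<partial>lborel) \<noteq> \<infinity>"
    then obtain B where B: "0 \<le> B" "(\<integral>\<^sup>+r. ?f \<omega> r \<partial>lborel) = ennreal B"
      by (cases "\<integral>\<^sup>+r. ?f \<omega> r \<partial>lborel") auto
    have "Gamma \<gamma> * c powr (- \<gamma>) \<le> B" if "0 < c" for c
    proof -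
      have "ennreal (Gamma \<gamma> * c powr (- \<gamma>)) =
          (\<integral>\<^sup>+r. ennreal (indicator {0<..} r * (r powr (\<gamma> - 1) * exp (- (c * r powr 1)))) \<partial>lborel)"
        using nn_gamma_powr_integral[of \<gamma> 1 c] that \<gamma> by (simp add: powr_minus divide_inverse)
      also have "\<dots> \<le> (\<integral>\<^sup>+r. ?f \<omega> r \<partial>lborel)"
        using that \<open>V \<omega> = 0\<close> by (intro nn_integral_mono) (auto simp: indicator_def mult_left_le intro!: ennreal_leI)
      finally show ?thesis using B by simp
    qed
    \<comment> \<open>This \<open>c\<close> solves
      \<open>Gamma \<gamma> * c powr (- \<gamma>) = B + 1\<close>.\<close>
    from this[of "((B + 1) / Gamma \<gamma>) powr (- (1 / \<gamma>))"] show False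
      using B \<Gamma> \<gamma> by (simp add: powr_powr)
  qed
  \<comment> \<open>The double integral is finite, so the inner one is finite almost surely, and
    this rules out \<open>V \<omega> = 0\<close>.\<close>
  have "AE \<omega> in M. (\<integral>\<^sup>+r. ?f \<omega> r \<partial>lborel) \<noteq> \<infinity>"
    by (rule nn_integral_PInf_AE) (use total in auto)
  with nonneg show pos: "AE \<omega> in M. 0 < V \<omega>"
    by eventually_elim (use at_zero in \<open>force simp: less_le\<close>)
  have nn: "(\<integral>\<^sup>+\<omega>. ennreal (Gamma \<gamma> * V \<omega> powr (- \<gamma>)) \<partial>M) = ennreal (Gamma (\<gamma> / \<beta>) / \<beta>)"
    unfolding total[symmetric] by (rule nn_integral_cong_AE) (use pos inner in auto)
  have "has_bochner_integral M (\<lambda>\<omega>. Gamma \<gamma> * V \<omega> powr (- \<gamma>)) (Gamma (\<gamma> / \<beta>) / \<beta>)"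
    using \<Gamma> \<Gamma>' \<beta> by (intro has_bochner_integral_nn_integral nn) auto
  from has_bochner_integral_mult_right[OF this, of "1 / Gamma \<gamma>"]
  have "has_bochner_integral M (\<lambda>\<omega>. V \<omega> powr (- \<gamma>)) (Gamma (\<gamma> / \<beta>) / (\<beta> * Gamma \<gamma>))"
    using \<Gamma> by (simp add: mult.commute)
  then show "integrable M (\<lambda>\<omega>. V \<omega> powr (- \<gamma>))"
    "(\<integral>\<omega>. V \<omega> powr (- \<gamma>) \<partial>M) = Gamma (\<gamma> / \<beta>) / (\<beta> * Gamma \<gamma>)"
    by (auto simp: has_bochner_integral_iff)
qed

text \<open>Since \<open>Z\<close> lies in \<open>[0,1]\<close>, any bound on a function there
  becomes a bound by a multiple of the integrable weight \<open>w\<close>. Applied to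
  \<open>\<phi>\<close> and to \<open>\<phi> - \<psi>\<close>, this controls the error of replacing
  \<open>\<phi>\<close> by a polynomial through the total mass of \<open>w\<close>.\<close>

lemma weighted_approximation:
  fixes w Z :: "'a \<Rightarrow> real" and \<phi> \<psi> :: "real \<Rightarrow> real"
  assumes w: "integrable M w" "AE x in M. 0 \<le> w x"
    and Z [measurable]: "Z \<in> borel_measurable M" and Z01: "AE x in M. Z x \<in> {0..1}"
    and [measurable]: "\<phi> \<in> borel_measurable borel" "\<psi> \<in> borel_measurable borel"
    and B: "\<And>z. z \<in> {0..1} \<Longrightarrow> \<bar>\<phi> z\<bar> \<le> B"
    and close: "\<And>z. z \<in> {0..1} \<Longrightarrow> \<bar>\<phi> z - \<psi> z\<bar> \<le> \<delta>"
  shows "integrable M (\<lambda>x. w x * \<phi> (Z x))"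
    and "\<bar>(\<integral>x. w x * \<phi> (Z x) \<partial>M) - (\<integral>x. w x * \<psi> (Z x) \<partial>M)\<bar> \<le> \<delta> * (\<integral>x. w x \<partial>M)"
proof -
  have [measurable]: "w \<in> borel_measurable M" using w(1) by simp
  have int: "integrable M (\<lambda>x. w x * \<theta> (Z x))"
    if [measurable]: "\<theta> \<in> borel_measurable borel" and le: "\<And>z. z \<in> {0..1} \<Longrightarrow> \<bar>\<theta> z\<bar> \<le> K" for \<theta> K
  proof (rule Bochner_Integration.integrable_bound)
    show "integrable M (\<lambda>x. K * w x)" using w by simp
    show "AE x in M. norm (w x * \<theta> (Z x)) \<le> norm (K * w x)"
      using w(2) Z01
    proof eventually_elim
      case (elim x)
      then have "\<bar>\<theta> (Z x)\<bar> \<le> \<bar>K\<bar>" using le[of "Z x"] by simp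
      with elim have "w x * \<bar>\<theta> (Z x)\<bar> \<le> w x * \<bar>K\<bar>" by (intro mult_left_mono)
      with elim show ?case by (simp add: abs_mult mult.commute)
    qed
  qed measurable
  show \<phi>: "integrable M (\<lambda>x. w x * \<phi> (Z x))"
    using B by (rule int[rotated]) measurable
  have \<psi>: "integrable M (\<lambda>x. w x * \<psi> (Z x))"
  proof (rule int)
    show "\<bar>\<psi> z\<bar> \<le> B + \<delta>" if "z \<in> {0..1}" for z
      using B[OF that] close[OF that] by linarith
  qed measurable
  have d: "integrable M (\<lambda>x. w x * (\<phi> (Z x) - \<psi> (Z x)))"
    using Bochner_Integration.integrable_diff[OF \<phi> \<psi>] by (simp add: algebra_simps)
  have "\<bar>(\<integral>x. w x * \<phi> (Z x) \<partial>M) - (\<integral>x. w x * \<psi> (Z x) \<partial>M)\<bar> = \<bar>\<integral>x. w x * (\<phi> (Z x) - \<psi> (Z x)) \<partial>M\<bar>"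
    by (subst Bochner_Integration.integral_diff[OF \<phi> \<psi>, symmetric]) (simp add: algebra_simps)
  also have "\<dots> \<le> (\<integral>x. \<bar>w x * (\<phi> (Z x) - \<psi> (Z x))\<bar> \<partial>M)"
    by (rule integral_abs_bound)
  also have "\<dots> \<le> (\<integral>x. \<delta> * w x \<partial>M)"
  proof (rule integral_mono_AE)
    show "AE x in M. \<bar>w x * (\<phi> (Z x) - \<psi> (Z x))\<bar> \<le> \<delta> * w x"
      using w(2) Z01
    proof eventually_elim
      case (elim x)
      then have "w x * \<bar>\<phi> (Z x) - \<psi> (Z x)\<bar> \<le> w x * \<delta>" by (intro mult_left_mono close)
      with elim show ?case by (simp add: abs_mult mult.commute)
    qed
  qed (use d w in auto)
  finally show "\<bar>(\<integral>x. w x * \<phi> (Z x) \<partial>M) - (\<integral>x. w x * \<psi> (Z x) \<partial>M)\<bar> \<le> \<delta> * (\<integral>x. w x \<partial>M)"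
    by simp
qed

text \<open>The method of moments on \<open>[0,1]\<close>: the moments give convergence for
  polynomials, polynomials are uniformly dense among the continuous functions, and convergence of
  the zeroth moment keeps the total masses bounded.\<close>

lemma weighted_moment_convergence:
  fixes M :: "'i \<Rightarrow> 'a measure" and M' :: "'b measure" and G :: "'i filter" and \<phi> :: "real \<Rightarrow> real"
  assumes fam: "eventually (\<lambda>i. integrable (M i) (w i) \<and> (AE x in M i. 0 \<le> w i x) \<and>
        Z i \<in> borel_measurable (M i) \<and> (AE x in M i. Z i x \<in> {0..1})) G"
    and w': "integrable M' w'" "AE x in M'. 0 \<le> w' x"
    and Z': "Z' \<in> borel_measurable M'" "AE x in M'. Z' x \<in> {0..1}"
    and moments: "\<And>j::nat. ((\<lambda>i. \<integral>x. w i x * Z i x ^ j \<partial>M i) \<longlongrightarrow> (\<integral>x. w' x * Z' x ^ j \<partial>M')) G"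
    and \<phi> [measurable]: "\<phi> \<in> borel_measurable borel" and cont: "continuous_on {0..1} \<phi>"
  shows "((\<lambda>i. \<integral>x. w i x * \<phi> (Z i x) \<partial>M i) \<longlongrightarrow> (\<integral>x. w' x * \<phi> (Z' x) \<partial>M')) G"
proof (rule tendstoI)
  fix e :: real assume e: "0 < e"
  let ?m = "\<integral>x. w' x \<partial>M'"
  have m: "0 \<le> ?m" using w' by (intro integral_nonneg_AE)
  obtain B where B: "\<And>z. z \<in> {0..1} \<Longrightarrow> \<bar>\<phi> z\<bar> \<le> B"
    using compact_imp_bounded[OF compact_continuous_image[OF cont compact_Icc]]
    by (auto simp: bounded_iff simp del: atLeastAtMost_iff)
  \<comment> \<open>Eventually the total masses are below \<open>?m + 1\<close>, so passing from
    \<open>\<phi>\<close> to \<open>\<psi>\<close> costs at most \<open>e / 4\<close> along the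
    family and less than \<open>e / 4\<close> at the limit; the convergence for
    \<open>\<psi>\<close> takes the remaining \<open>e / 2\<close>.\<close>
  define \<delta> where "\<delta> = e / (4 * (?m + 1))"
  have \<delta>: "0 < \<delta>" "\<delta> * (?m + 1) = e / 4" using e m by (simp_all add: \<delta>_def field_simps)
  obtain \<psi> where \<psi>: "real_polynomial_function \<psi>" "\<And>z. z \<in> {0..1} \<Longrightarrow> \<bar>\<phi> z - \<psi> z\<bar> < \<delta>"
    using Stone_Weierstrass_real_polynomial_function[OF compact_Icc cont \<delta>(1)] by blast
  then obtain a N where \<psi>_def: "\<psi> = (\<lambda>z. \<Sum>j\<le>N. a j * z ^ j)"
    by (auto simp: real_polynomial_function_iff_sum)
  have [measurable]: "\<psi> \<in> borel_measurable borel"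
    unfolding \<psi>_def by measurable
  \<comment> \<open>Stated over a space of arbitrary type, so that it applies both to
    \<open>M i\<close> and to \<open>M'\<close>.\<close>
  have poly: "(\<integral>x. v x * \<psi> (Y x) \<partial>K) = (\<Sum>j\<le>N. a j * (\<integral>x. v x * Y x ^ j \<partial>K))"
    if "integrable K v" "AE x in K. 0 \<le> v x" "Y \<in> borel_measurable K" "AE x in K. Y x \<in> {0..1}"
    for K :: "'c measure" and v Y
  proof -
    have "integrable K (\<lambda>x. v x * Y x ^ j)" for j
      by (rule weighted_approximation(1)[OF that, of _ "\<lambda>z. z ^ j" 1 0]) (auto simp: power_le_one)
    then show ?thesis
      by (simp add: \<psi>_def sum_distrib_left mult.left_commute)
  qed
  have "((\<lambda>i. \<Sum>j\<le>N. a j * (\<integral>x. w i x * Z i x ^ j \<partial>M i)) \<longlongrightarrow>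
      (\<Sum>j\<le>N. a j * (\<integral>x. w' x * Z' x ^ j \<partial>M'))) G"
    by (intro tendsto_intros moments)
  then have "eventually (\<lambda>i. dist (\<Sum>j\<le>N. a j * (\<integral>x. w i x * Z i x ^ j \<partial>M i))
      (\<Sum>j\<le>N. a j * (\<integral>x. w' x * Z' x ^ j \<partial>M')) < e / 2) G"
    using e by (intro tendstoD) auto
  moreover have "eventually (\<lambda>i. (\<integral>x. w i x \<partial>M i) < ?m + 1) G"
    using order_tendstoD(2)[OF moments[of 0], of "?m + 1"] by simp
  ultimately show "eventually (\<lambda>i. dist (\<integral>x. w i x * \<phi> (Z i x) \<partial>M i) (\<integral>x. w' x * \<phi> (Z' x) \<partial>M') < e) G"
    using fam
  proof eventually_elim
    case (elim i)
    then have i: "integrable (M i) (w i)" "AE x in M i. 0 \<le> w i x"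
        "Z i \<in> borel_measurable (M i)" "AE x in M i. Z i x \<in> {0..1}"
      by auto
    have le: "\<And>z. z \<in> {0..1} \<Longrightarrow> \<bar>\<phi> z - \<psi> z\<bar> \<le> \<delta>"
      using \<psi>(2) by (simp add: less_imp_le)
    have "\<bar>(\<integral>x. w i x * \<phi> (Z i x) \<partial>M i) - (\<integral>x. w i x * \<psi> (Z i x) \<partial>M i)\<bar> \<le> \<delta> * (\<integral>x. w i x \<partial>M i)"
      by (rule weighted_approximation(2)[OF i _ _ B le]) measurable
    also have "\<dots> \<le> e / 4"
      using elim(2) \<delta> by (metis less_imp_le mult_left_mono)
    finally have 1: "\<bar>(\<integral>x. w i x * \<phi> (Z i x) \<partial>M i) - (\<integral>x. w i x * \<psi> (Z i x) \<partial>M i)\<bar> \<le> e / 4" .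
    have "\<bar>(\<integral>x. w' x * \<phi> (Z' x) \<partial>M') - (\<integral>x. w' x * \<psi> (Z' x) \<partial>M')\<bar> \<le> \<delta> * ?m"
      by (rule weighted_approximation(2)[OF w' Z' _ _ B le]) measurable
    also have "\<dots> < e / 4"
      using \<delta> by (simp add: algebra_simps)
    finally have 2: "\<bar>(\<integral>x. w' x * \<phi> (Z' x) \<partial>M') - (\<integral>x. w' x * \<psi> (Z' x) \<partial>M')\<bar> < e / 4" .
    show ?case
      using 1 2 elim(1) unfolding poly[OF i, symmetric] poly[OF w' Z', symmetric] dist_real_def
      by linarith
  qed
qed

text \<open>The limit is the integral of \<open>f\<close> against the Levy measure of the stable
  subordinator, whose density is
  \<open>\<beta> / Gamma (1 - \<beta>) * u powr (- 1 - \<beta>)\<close>. That measure is infinite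
  near 0; the factor \<open>1 - exp (- u)\<close> makes it finite, and the limits
  \<open>l\<^sub>0\<close> and \<open>l\<^sub>1\<close> make the remaining factor \<open>k\<close>
  continuous on the compactified half-line.\<close>

lemma small_time_limit:
  fixes M :: "'i \<Rightarrow> 'w measure" and V :: "'i \<Rightarrow> 'w \<Rightarrow> real" and \<epsilon> :: "'i \<Rightarrow> real"
    and k :: "real \<Rightarrow> real" and \<beta> l\<^sub>0 l\<^sub>1 :: real
  assumes \<beta>: "0 < \<beta>" "\<beta> < 1"
    and fam: "eventually (\<lambda>i. prob_space (M i) \<and> V i \<in> borel_measurable (M i) \<and> (AE \<omega> in M i. 0 \<le> V i \<omega>) \<and>
        0 < \<epsilon> i \<and> (\<forall>r>0. (\<integral>\<omega>. exp (- (r * V i \<omega>)) \<partial>M i) = exp (- (\<epsilon> i * r powr \<beta>)))) G"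
    and \<epsilon>: "(\<epsilon> \<longlongrightarrow> 0) G"
    and k_meas [measurable]: "k \<in> borel_measurable borel"
    and k: "continuous_on {0<..} k" "(k \<longlongrightarrow> l\<^sub>0) (at_right 0)" "(k \<longlongrightarrow> l\<^sub>1) at_top"
  defines "f \<equiv> \<lambda>u. (1 - exp (- u)) * k u"
  shows "set_integrable lborel {0<..} (\<lambda>u. f u * u powr (- 1 - \<beta>))"
    and "((\<lambda>i. (\<integral>\<omega>. f (V i \<omega>) \<partial>M i) / \<epsilon> i) \<longlongrightarrow>
      \<beta> / Gamma (1 - \<beta>) * (LBINT u:{0<..}. f u * u powr (- 1 - \<beta>))) G"
proof -
  define q where "q = \<beta> / Gamma (1 - \<beta>)"
  have "0 < Gamma (1 - \<beta>)" using \<beta> by (simp add: Gamma_real_pos)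
  then have \<Gamma>: "Gamma (1 - \<beta>) \<noteq> 0" by (rule less_imp_neq[THEN not_sym])
  have q: "0 < q" using \<beta> by (simp add: q_def Gamma_real_pos)
  define w where "w = (\<lambda>i \<omega>. (1 - exp (- V i \<omega>)) / \<epsilon> i)"
  define Z where "Z = (\<lambda>i \<omega>. exp (- V i \<omega>))"
  define w' where "w' = (\<lambda>u::real. indicator {0<..} u * (q * ((1 - exp (- u)) * u powr (- 1 - \<beta>))))"
  \<comment> \<open>The absolute value keeps \<open>Z'\<close> in \<open>[0,1]\<close> on the
    negative half-line too, where \<open>w'\<close> vanishes.\<close>
  define Z' where "Z' = (\<lambda>u::real. exp (- \<bar>u\<bar>))"
  \<comment> \<open>Substituting \<open>z = exp (- u)\<close> turns Laplace transforms at integers into moments on \<open>[0,1]\<close>.\<close>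
  define \<phi>\<^sub>0 where "\<phi>\<^sub>0 = (\<lambda>z. if z = 0 then l\<^sub>1 else if z = 1 then l\<^sub>0 else k (- ln z))"
  \<comment> \<open>Clamping the argument to \<open>[0,1]\<close> makes the function continuous on
    the whole line and hence Borel.\<close>
  define \<phi> where "\<phi> = (\<lambda>z. \<phi>\<^sub>0 (max 0 (min 1 z)))"
  have "continuous_on {0..1} \<phi>\<^sub>0"
    unfolding continuous_on_eq_continuous_within
  proof
    fix z :: real assume z: "z \<in> {0..1}"
    \<comment> \<open>The end point \<open>z = 0\<close> corresponds to \<open>u\<close> tending to
      infinity and \<open>z = 1\<close> to \<open>u\<close> tending to 0, so continuity there is
      what the two limits of \<open>k\<close> say.\<close>
    consider "z = 0" | "z = 1" | "0 < z" "z < 1" using z by fastforce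
    then show "continuous (at z within {0..1}) \<phi>\<^sub>0"
    proof cases
      case 1
      have "filterlim (\<lambda>z::real. - ln z) at_top (at_right 0)" by real_asymp
      from filterlim_compose[OF k(3) this] have "((\<lambda>z. k (- ln z)) \<longlongrightarrow> l\<^sub>1) (at_right 0)" .
      moreover have "eventually (\<lambda>z. k (- ln z) = \<phi>\<^sub>0 z) (at_right 0)"
        by (auto simp: \<phi>\<^sub>0_def eventually_at_right_field intro!: exI[of _ 1])
      ultimately have "(\<phi>\<^sub>0 \<longlongrightarrow> l\<^sub>1) (at_right 0)" by (rule Lim_transform_eventually)
      with 1 show ?thesis
        by (simp add: continuous_within at_within_Icc_at_right \<phi>\<^sub>0_def)
    next
      case 2
      have "filterlim (\<lambda>z::real. - ln z) (at_right 0) (at_left 1)" by real_asymp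
      from filterlim_compose[OF k(2) this] have "((\<lambda>z. k (- ln z)) \<longlongrightarrow> l\<^sub>0) (at_left 1)" .
      moreover have "eventually (\<lambda>z. k (- ln z) = \<phi>\<^sub>0 z) (at_left 1)"
        by (auto simp: \<phi>\<^sub>0_def eventually_at_left_field intro!: exI[of _ 0])
      ultimately have "(\<phi>\<^sub>0 \<longlongrightarrow> l\<^sub>0) (at_left 1)" by (rule Lim_transform_eventually)
      with 2 show ?thesis
        by (simp add: continuous_within at_within_Icc_at_left \<phi>\<^sub>0_def)
    next
      case 3
      have "continuous_on {0<..<1} (\<lambda>z. k (- ln z))"
        by (rule continuous_on_compose2[OF k(1)]) (auto intro!: continuous_intros)
      then have "continuous_on {0<..<1} \<phi>\<^sub>0"
        by (rule continuous_on_eq) (auto simp: \<phi>\<^sub>0_def)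
      with 3 have "isCont \<phi>\<^sub>0 z"
        by (simp add: continuous_on_eq_continuous_at)
      then show ?thesis by (rule continuous_at_imp_continuous_within)
    qed
  qed
  then have \<phi>_cont: "continuous_on UNIV \<phi>"
    unfolding \<phi>_def by (rule continuous_on_compose2) (auto intro!: continuous_intros)
  then have [measurable]: "\<phi> \<in> borel_measurable borel"
    by (rule borel_measurable_continuous_onI)
  have \<phi>_exp: "\<phi> (exp (- u)) = k u" if "0 < u" for u
    using that by (simp add: \<phi>_def \<phi>\<^sub>0_def)
  have limit: "set_integrable lborel {0<..} (\<lambda>u. (1 - exp (- u)) * u powr (- 1 - \<beta>) * exp (- (real j * u)))"
      "(LBINT u:{0<..}. (1 - exp (- u)) * u powr (- 1 - \<beta>) * exp (- (real j * u))) =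
       Gamma (1 - \<beta>) / \<beta> * ((real j + 1) powr \<beta> - real j powr \<beta>)" for j
    using levy_moment_integral[OF \<beta>, of "real j"] by simp_all
  have w': "integrable lborel w'"
    using limit(1)[of 0] by (simp add: set_integrable_def w'_def mult.left_commute)
  have w'_nonneg: "AE u in lborel. 0 \<le> w' u"
    using q by (auto simp: w'_def indicator_def)
  have Z': "Z' \<in> borel_measurable lborel" "AE u in lborel. Z' u \<in> {0..1}"
    unfolding Z'_def by auto
  have limit_moment: "(\<integral>u. w' u * Z' u ^ j \<partial>lborel) = (real j + 1) powr \<beta> - real j powr \<beta>" for j :: nat
  proof -
    have "(\<integral>u. w' u * Z' u ^ j \<partial>lborel) =
        (\<integral>u. q * (indicator {0<..} u * ((1 - exp (- u)) * u powr (- 1 - \<beta>) * exp (- (real j * u)))) \<partial>lborel)"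
      by (intro Bochner_Integration.integral_cong)
        (auto simp: w'_def Z'_def indicator_def exp_of_nat_mult[symmetric])
    also have "\<dots> = q * (LBINT u:{0<..}. (1 - exp (- u)) * u powr (- 1 - \<beta>) * exp (- (real j * u)))"
      by (simp add: set_lebesgue_integral_def)
    also have "\<dots> = (real j + 1) powr \<beta> - real j powr \<beta>"
      using \<Gamma> \<beta> by (simp add: limit(2) q_def)
    finally show ?thesis .
  qed
  have moments: "((\<lambda>i. \<integral>\<omega>. w i \<omega> * Z i \<omega> ^ j \<partial>M i) \<longlongrightarrow> (\<integral>u. w' u * Z' u ^ j \<partial>lborel)) G" for j :: nat
  proof -
    let ?a = "real j powr \<beta>" and ?b = "(real j + 1) powr \<beta>"
    \<comment> \<open>The moments of the family are difference quotients of this function at step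
      \<open>\<epsilon> i\<close>, because \<open>(1 - z) * z ^ j\<close> is the difference of two
      consecutive powers of \<open>z = exp (- V)\<close>. Their limit is the derivative at
      0.\<close>
    have "((\<lambda>h. exp (- (h * ?a)) - exp (- (h * ?b))) has_real_derivative (?b - ?a)) (at 0)"
      by (auto intro!: derivative_eq_intros)
    then have "((\<lambda>h. (exp (- (h * ?a)) - exp (- (h * ?b))) / h) \<longlongrightarrow> ?b - ?a) (at 0)"
      by (simp add: DERIV_def)
    moreover have "filterlim \<epsilon> (at 0) G"
      using \<epsilon> fam by (auto simp: filterlim_at elim: eventually_mono)
    ultimately have "((\<lambda>i. (exp (- (\<epsilon> i * ?a)) - exp (- (\<epsilon> i * ?b))) / \<epsilon> i) \<longlongrightarrow> ?b - ?a) G"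
      by (rule filterlim_compose)
    moreover have "eventually (\<lambda>i. (exp (- (\<epsilon> i * ?a)) - exp (- (\<epsilon> i * ?b))) / \<epsilon> i =
        (\<integral>\<omega>. w i \<omega> * Z i \<omega> ^ j \<partial>M i)) G"
      using fam
    proof eventually_elim
      case (elim i)
      then interpret prob_space "M i" by simp
      have [measurable]: "V i \<in> borel_measurable (M i)" and V: "AE \<omega> in M i. 0 \<le> V i \<omega>"
        using elim by auto
      have int: "integrable (M i) (\<lambda>\<omega>. exp (- (r * V i \<omega>)))" if "0 \<le> r" for r
        using V that by (intro integrable_const_bound[of _ 1]) auto
      \<comment> \<open>The value \<open>r = 0\<close>, which occurs for \<open>j = 0\<close>, is
        covered by total mass 1 and \<open>0 powr \<beta> = 0\<close>.\<close>
      have laplace: "(\<integral>\<omega>. exp (- (r * V i \<omega>)) \<partial>M i) = exp (- (\<epsilon> i * r powr \<beta>))" if "0 \<le> r" for r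
        using elim that by (cases "r = 0") (auto simp: prob_space)
      have "(\<integral>\<omega>. w i \<omega> * Z i \<omega> ^ j \<partial>M i) =
          (\<integral>\<omega>. (exp (- (real j * V i \<omega>)) - exp (- ((real j + 1) * V i \<omega>))) / \<epsilon> i \<partial>M i)"
        by (intro Bochner_Integration.integral_cong)
          (auto simp: w_def Z_def exp_of_nat_mult[symmetric] algebra_simps exp_add[symmetric])
      also have "\<dots> = (exp (- (\<epsilon> i * ?a)) - exp (- (\<epsilon> i * ?b))) / \<epsilon> i"
        using int[of "real j"] int[of "real j + 1"] laplace[of "real j"] laplace[of "real j + 1"] by simp
      finally show ?case by simp
    qed
    ultimately have "((\<lambda>i. \<integral>\<omega>. w i \<omega> * Z i \<omega> ^ j \<partial>M i) \<longlongrightarrow> ?b - ?a) G"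
      by (rule Lim_transform_eventually)
    then show ?thesis by (simp only: limit_moment)
  qed
  have weights: "eventually (\<lambda>i. integrable (M i) (w i) \<and> (AE \<omega> in M i. 0 \<le> w i \<omega>) \<and>
        Z i \<in> borel_measurable (M i) \<and> (AE \<omega> in M i. Z i \<omega> \<in> {0..1})) G"
    using fam
  proof eventually_elim
    case (elim i)
    then interpret prob_space "M i" by simp
    have [measurable]: "V i \<in> borel_measurable (M i)" and V: "AE \<omega> in M i. 0 \<le> V i \<omega>"
      using elim by auto
    have "integrable (M i) (\<lambda>\<omega>. exp (- V i \<omega>))"
      using V by (intro integrable_const_bound[of _ 1]) auto
    with V elim show ?case
      by (auto simp: w_def Z_def)
  qed
  have conv: "((\<lambda>i. \<integral>\<omega>. w i \<omega> * \<phi> (Z i \<omega>) \<partial>M i) \<longlongrightarrow> (\<integral>u. w' u * \<phi> (Z' u) \<partial>lborel)) G"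
    using continuous_on_subset[OF \<phi>_cont subset_UNIV]
    by (rule weighted_moment_convergence[OF weights w' w'_nonneg Z' moments, rotated]) measurable
  have w'_eq: "(\<lambda>u. w' u * \<phi> (Z' u)) = (\<lambda>u. q * (indicator {0<..} u * (f u * u powr (- 1 - \<beta>))))"
    by (auto simp: w'_def Z'_def f_def \<phi>_exp indicator_def)
  have "compact (\<phi> ` {0..1})"
    by (rule compact_continuous_image) (auto intro: continuous_on_subset[OF \<phi>_cont])
  then obtain B where "\<forall>y\<in>\<phi> ` {0..1}. norm y \<le> B"
    using compact_imp_bounded bounded_iff by metis
  then have "\<And>z. z \<in> {0..1} \<Longrightarrow> \<bar>\<phi> z\<bar> \<le> B"
    by (metis imageI real_norm_def)
  \<comment> \<open>Only the integrability claim is wanted, so \<open>\<phi>\<close> serves as its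
    own approximation with error 0.\<close>
  then have "integrable lborel (\<lambda>u. w' u * \<phi> (Z' u))"
    using weighted_approximation(1)[OF w' w'_nonneg Z', of \<phi> \<phi> B 0] by simp
  with q show "set_integrable lborel {0<..} (\<lambda>u. f u * u powr (- 1 - \<beta>))"
    by (simp add: w'_eq set_integrable_def)
  have "eventually (\<lambda>i. (\<integral>\<omega>. w i \<omega> * \<phi> (Z i \<omega>) \<partial>M i) = (\<integral>\<omega>. f (V i \<omega>) \<partial>M i) / \<epsilon> i) G"
    using fam
  proof eventually_elim
    case (elim i)
    then have [measurable]: "V i \<in> borel_measurable (M i)" and V: "AE \<omega> in M i. 0 \<le> V i \<omega>"
      by auto
    \<comment> \<open>At \<open>u = 0\<close> the first factor vanishes on both sides, so
      \<open>k 0\<close> may differ from \<open>l\<^sub>0\<close>.\<close>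
    have *: "f u = (1 - exp (- u)) * \<phi> (exp (- u))" if "0 \<le> u" for u
      using that by (cases "u = 0") (auto simp: f_def \<phi>_exp)
    have "(\<integral>\<omega>. f (V i \<omega>) \<partial>M i) = (\<integral>\<omega>. (1 - exp (- V i \<omega>)) * \<phi> (exp (- V i \<omega>)) \<partial>M i)"
    proof (rule integral_cong_AE)
      show "AE \<omega> in M i. f (V i \<omega>) = (1 - exp (- V i \<omega>)) * \<phi> (exp (- V i \<omega>))"
        using V by eventually_elim (rule *)
    qed (simp_all add: f_def)
    then show ?case by (simp add: w_def Z_def)
  qed
  from Lim_transform_eventually[OF conv this]
  show "((\<lambda>i. (\<integral>\<omega>. f (V i \<omega>) \<partial>M i) / \<epsilon> i) \<longlongrightarrow>
      \<beta> / Gamma (1 - \<beta>) * (LBINT u:{0<..}. f u * u powr (- 1 - \<beta>))) G"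
    by (simp add: w'_eq q_def set_lebesgue_integral_def)
qed

section \<open>Profile functions\<close>

text \<open>After this lemma the two profile types are treated alike. The linear bound on
  \<open>1 - F r\<close> serves the limit near the diagonal and the tail limit serves the one far
  from it; \<open>l\<close> is 0 for the exponential type and 1 for the polynomial type.\<close>

lemma profile_bounds:
  fixes F :: "real \<Rightarrow> real" and n \<alpha> :: real
  assumes n: "0 < n" and profile: "exponential_type \<alpha> F \<or> polynomial_type n \<alpha> F"
  obtains K l where "continuous_on {0..} F" "\<And>r. 0 \<le> r \<Longrightarrow> 0 < F r \<and> F r \<le> 1"
    "\<And>r. 0 \<le> r \<Longrightarrow> 1 - F r \<le> K * r" "((\<lambda>r. r powr (n + \<alpha>) * F r) \<longlongrightarrow> l) at_top"
  using profile
proof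
  assume "exponential_type \<alpha> F"
  then have \<alpha>: "2 \<le> \<alpha>" and F: "\<And>r. 0 \<le> r \<Longrightarrow> F r = exp (- (r powr (\<alpha> / (\<alpha> - 1))))"
    by (auto simp: exponential_type_def)
  define q where "q = \<alpha> / (\<alpha> - 1)"
  have q: "1 \<le> q" using \<alpha> by (simp add: q_def field_simps)
  note F = F[folded q_def]
  show thesis
  proof (rule that[of 1 0])
    have "continuous_on {0..} (\<lambda>r::real. exp (- (r powr q)))"
      using q by (auto intro!: continuous_intros continuous_on_powr')
    then show "continuous_on {0..} F"
      by (rule continuous_on_eq) (simp add: F)
    show "1 - F r \<le> 1 * r" if "0 \<le> r" for r
    proof (cases "r \<le> 1")
      case True
      then have "r powr q \<le> r" using q that powr_mono'[of 1 q r] by simp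
      then show ?thesis using exp_ge_add_one_self[of "- (r powr q)"] that by (simp add: F)
    next
      case False
      moreover have "0 < F r" using that by (simp add: F)
      ultimately show ?thesis by linarith
    qed
    have "((\<lambda>r. r powr (n + \<alpha>) * exp (- (r powr q))) \<longlongrightarrow> 0) at_top"
      using q n \<alpha> by real_asymp
    then show "((\<lambda>r. r powr (n + \<alpha>) * F r) \<longlongrightarrow> 0) at_top"
      by (rule Lim_transform_eventually) (use eventually_ge_at_top[of 0] in eventually_elim, simp add: F)
  qed (use F in auto)
next
  assume "polynomial_type n \<alpha> F"
  then have \<alpha>: "0 < \<alpha>" and F: "\<And>r. 0 \<le> r \<Longrightarrow> F r = (1 + r\<^sup>2) powr (- (n + \<alpha>) / 2)"
    by (auto simp: polynomial_type_def)
  define c where "c = (n + \<alpha>) / 2"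
  have c: "0 < c" using \<alpha> n by (simp add: c_def)
  have F: "F r = (1 + r\<^sup>2) powr (- c)" if "0 \<le> r" for r
    using F[OF that] by (simp only: c_def minus_divide_left)
  have pos: "0 < 1 + r\<^sup>2" for r :: real by (simp add: add_pos_nonneg)
  \<comment> \<open>In the constant \<open>c + 1\<close> the summand \<open>c\<close> handles
    \<open>r \<le> 1\<close>, while the summand 1 makes the bound exceed 1 for \<open>r > 1\<close>,
    where \<open>0 < F r\<close> suffices.\<close>
  show thesis
  proof (rule that[of "c + 1" 1])
    have "continuous_on {0..} (\<lambda>r::real. (1 + r\<^sup>2) powr (- c))"
      using pos by (auto intro!: continuous_intros simp: less_imp_neq[THEN not_sym])
    then show "continuous_on {0..} F"
      by (rule continuous_on_eq) (simp add: F)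
    show "0 < F r \<and> F r \<le> 1" if "0 \<le> r" for r
      using that c pos[of r] powr_mono2'[of "- c" 1 "1 + r\<^sup>2"] by (auto simp: F)
    then show "1 - F r \<le> (c + 1) * r" if "0 \<le> r" for r
    proof (cases "r \<le> 1")
      case True
      \<comment> \<open>With \<open>F r = exp (- c * ln (1 + r\<^sup>2))\<close>, the tangent bound
        for \<open>exp\<close> gives \<open>1 - F r \<le> c * ln (1 + r\<^sup>2)\<close>, and
        \<open>r\<^sup>2 \<le> r\<close> here.\<close>
      have "c * ln (1 + r\<^sup>2) \<le> c * r\<^sup>2"
        using c by (intro mult_left_mono ln_add_one_self_le_self) auto
      moreover have "1 - c * ln (1 + r\<^sup>2) \<le> F r"
        using exp_ge_add_one_self[of "- c * ln (1 + r\<^sup>2)"] that pos[of r] by (simp add: F powr_def)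
      moreover have "c * r\<^sup>2 \<le> (c + 1) * r"
        using True that c by (simp add: power2_eq_square mult_mono mult_left_le)
      ultimately show ?thesis by linarith
    next
      case False
      then have "1 * 1 \<le> (c + 1) * r" using c by (intro mult_mono) auto
      moreover have "0 < F r" using that pos[of r] by (simp add: F)
      ultimately show ?thesis by linarith
    qed
    have "((\<lambda>r::real. r powr (2 * c) * (1 + r\<^sup>2) powr (- c)) \<longlongrightarrow> 1) at_top"
      using c by real_asymp
    then have "((\<lambda>r. r powr (2 * c) * F r) \<longlongrightarrow> 1) at_top"
      by (rule Lim_transform_eventually) (use eventually_ge_at_top[of 0] in eventually_elim, simp add: F)
    moreover have "2 * c = n + \<alpha>" by (simp add: c_def)
    ultimately show "((\<lambda>r. r powr (n + \<alpha>) * F r) \<longlongrightarrow> 1) at_top" by simp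
  qed
qed

text \<open>Continuity of \<open>F\<close> is known only on the closed half-line. Precomposing with
  \<open>max 0\<close> extends \<open>F\<close> continuously to the whole line and does not change
  it at the nonnegative values of \<open>g\<close>.\<close>

lemma measurable_compose_nonneg:
  fixes F g :: "_ \<Rightarrow> real"
  assumes "continuous_on {0..} F" and [measurable]: "g \<in> borel_measurable M" and g: "\<And>x. 0 \<le> g x"
  shows "(\<lambda>x. F (g x)) \<in> borel_measurable M"
proof -
  have "continuous_on UNIV (\<lambda>r. F (max 0 r))"
    by (rule continuous_on_compose2[OF assms(1)]) (auto intro!: continuous_intros)
  then have [measurable]: "(\<lambda>r. F (max 0 r)) \<in> borel_measurable borel"
    by (rule borel_measurable_continuous_onI)
  have "(\<lambda>x. F (max 0 (g x))) \<in> borel_measurable M"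
    by measurable
  then show ?thesis using g by (simp add: max_absorb2)
qed

text \<open>As \<open>u\<close> tends to 0 the argument of \<open>F\<close> tends to infinity, and
  the tail limit makes the numerator equal to \<open>u\<close> times a factor tending to
  \<open>c powr (- (n + \<alpha>)) * l\<close>; the denominator behaves like \<open>u\<close>. At
  infinity \<open>F \<le> 1\<close> and the negative power of \<open>u\<close> forces the limit
  0.\<close>

lemma profile_quotient_limits:
  fixes F :: "real \<Rightarrow> real" and n \<alpha> c l :: real
  assumes pos: "0 < n" "0 < \<alpha>" "0 < c" and F: "continuous_on {0..} F"
    and F01: "\<And>r. 0 \<le> r \<Longrightarrow> 0 < F r \<and> F r \<le> 1"
    and tail: "((\<lambda>r. r powr (n + \<alpha>) * F r) \<longlongrightarrow> l) at_top"
  defines "k \<equiv> \<lambda>u. u powr (- (n / \<alpha>)) * F (c * u powr (- (1 / \<alpha>))) / (1 - exp (- u))"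
  shows "k \<in> borel_measurable borel" and "continuous_on {0<..} k"
    and "(k \<longlongrightarrow> c powr (- (n + \<alpha>)) * l) (at_right 0)" and "(k \<longlongrightarrow> 0) at_top"
proof -
  have [measurable]: "(\<lambda>u. F (c * u powr (- (1 / \<alpha>)))) \<in> borel_measurable borel"
    using pos by (intro measurable_compose_nonneg[OF F]) auto
  show "k \<in> borel_measurable borel" unfolding k_def by measurable
  have "continuous_on {0<..} (\<lambda>u. F (c * u powr (- (1 / \<alpha>))))"
    using pos by (intro continuous_on_compose2[OF F]) (auto intro!: continuous_intros)
  then show "continuous_on {0<..} k"
    unfolding k_def by (auto intro!: continuous_intros)
  have "filterlim (\<lambda>u. c * u powr (- (1 / \<alpha>))) at_top (at_right 0)"
    using pos by real_asymp
  from filterlim_compose[OF tail this]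
  have "((\<lambda>u. (c * u powr (- (1 / \<alpha>))) powr (n + \<alpha>) * F (c * u powr (- (1 / \<alpha>)))) \<longlongrightarrow> l) (at_right 0)" .
  moreover have "((\<lambda>u::real. u / (1 - exp (- u))) \<longlongrightarrow> 1) (at_right 0)"
    by real_asymp
  ultimately have "((\<lambda>u. c powr (- (n + \<alpha>)) * ((c * u powr (- (1 / \<alpha>))) powr (n + \<alpha>) * F (c * u powr (- (1 / \<alpha>)))) *
      (u / (1 - exp (- u)))) \<longlongrightarrow> c powr (- (n + \<alpha>)) * l * 1) (at_right 0)"
    by (intro tendsto_intros)
  moreover have "eventually (\<lambda>u. c powr (- (n + \<alpha>)) * ((c * u powr (- (1 / \<alpha>))) powr (n + \<alpha>) * F (c * u powr (- (1 / \<alpha>)))) *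
      (u / (1 - exp (- u))) = k u) (at_right 0)"
    using eventually_at_right_less
  proof eventually_elim
    case (elim u)
    have "c powr (- (n + \<alpha>)) * (c * u powr (- (1 / \<alpha>))) powr (n + \<alpha>) * u = u powr (- ((n + \<alpha>) / \<alpha>)) * u"
      using pos elim by (simp add: powr_mult powr_powr powr_add[symmetric] flip: mult.assoc)
    also have "\<dots> = u powr (- (n / \<alpha>))"
      using pos elim powr_add[of u "- ((n + \<alpha>) / \<alpha>)" 1] by (simp add: add_divide_distrib)
    finally show ?case by (simp add: k_def)
  qed
  ultimately show "(k \<longlongrightarrow> c powr (- (n + \<alpha>)) * l) (at_right 0)"
    by (auto intro: Lim_transform_eventually)
  have "((\<lambda>u. u powr (- (n / \<alpha>)) / (1 - exp (- u))) \<longlongrightarrow> 0) at_top"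
    using pos by real_asymp
  moreover have "eventually (\<lambda>u. norm (k u) \<le> u powr (- (n / \<alpha>)) / (1 - exp (- u))) at_top"
    using eventually_gt_at_top[of 0]
  proof eventually_elim
    case (elim u)
    have "0 < F (c * u powr (- (1 / \<alpha>)))" "F (c * u powr (- (1 / \<alpha>))) \<le> 1"
      using F01[of "c * u powr (- (1 / \<alpha>))"] pos by auto
    with elim show ?case
      by (auto simp: k_def abs_mult intro!: divide_right_mono mult_left_le)
  qed
  ultimately show "(k \<longlongrightarrow> 0) at_top"
    by (rule Lim_null_comparison[rotated])
qed

text \<open>The substitution \<open>s = c * u powr (- (1 / \<alpha>))\<close> converts the integral
  against the Levy density into the moment of \<open>F\<close> in the theorem. Positivity is
  recorded because the asymptotic constant has to be divided by.\<close>

lemma profile_levy_integral: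
  fixes F :: "real \<Rightarrow> real" and n \<alpha> \<beta> c :: real
  assumes pos: "0 < n" "0 < \<alpha>" "0 < c" "0 < \<beta>" and F: "continuous_on {0..} F"
    and F_pos: "\<And>r. 0 \<le> r \<Longrightarrow> 0 < F r"
    and int: "set_integrable lborel {0<..}
        (\<lambda>u. u powr (- (n / \<alpha>)) * F (c * u powr (- (1 / \<alpha>))) * u powr (- 1 - \<beta>))"
  shows "(LBINT u:{0<..}. u powr (- (n / \<alpha>)) * F (c * u powr (- (1 / \<alpha>))) * u powr (- 1 - \<beta>)) =
      \<alpha> * c powr (- n - \<alpha> * \<beta>) * (LBINT s:{0<..}. s powr (n + \<alpha> * \<beta> - 1) * F s)" (is "?I = _")
    and "0 < (LBINT u:{0<..}. u powr (- (n / \<alpha>)) * F (c * u powr (- (1 / \<alpha>))) * u powr (- 1 - \<beta>))"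
proof -
  let ?g = "\<lambda>u. u powr (- (n / \<alpha>)) * F (c * u powr (- (1 / \<alpha>))) * u powr (- 1 - \<beta>)"
  let ?a = "- (1 / \<alpha>)" and ?f = "\<lambda>s. s powr (n + \<alpha> * \<beta> - 1) * F (max 0 s)"
  have "continuous_on UNIV (\<lambda>r. F (max 0 r))"
    by (rule continuous_on_compose2[OF F]) (auto intro!: continuous_intros)
  then have [measurable]: "(\<lambda>r. F (max 0 r)) \<in> borel_measurable borel"
    by (rule borel_measurable_continuous_onI)
  have f: "?f \<in> borel_measurable borel" by measurable
  \<comment> \<open>The exponents of \<open>u\<close> add up by \<open>- 1 / \<alpha> - 1 - (n +
    \<alpha> * \<beta> - 1) / \<alpha> = - n / \<alpha> - 1 - \<beta>\<close>.\<close>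
  have eq: "\<bar>?a\<bar> * c * u powr (?a - 1) * ?f (c * u powr ?a) = c powr (n + \<alpha> * \<beta>) / \<alpha> * ?g u" if u: "0 < u" for u
  proof -
    have 1: "(c * u powr ?a) powr (n + \<alpha> * \<beta> - 1) =
        c powr (n + \<alpha> * \<beta> - 1) * u powr (?a * (n + \<alpha> * \<beta> - 1))"
      using u pos by (simp add: powr_mult powr_powr)
    have 2: "c * c powr (n + \<alpha> * \<beta> - 1) = c powr (n + \<alpha> * \<beta>)"
      using pos by (simp add: powr_diff)
    have 3: "u powr (?a - 1) * u powr (?a * (n + \<alpha> * \<beta> - 1)) = u powr (- (n / \<alpha>)) * u powr (- 1 - \<beta>)"
      unfolding powr_add[symmetric] using pos by (simp add: field_simps)
    have "c * u powr (?a - 1) * (c * u powr ?a) powr (n + \<alpha> * \<beta> - 1) =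
        (c * c powr (n + \<alpha> * \<beta> - 1)) * (u powr (?a - 1) * u powr (?a * (n + \<alpha> * \<beta> - 1)))"
      unfolding 1 by (simp only: mult_ac)
    also have "\<dots> = c powr (n + \<alpha> * \<beta>) * (u powr (- (n / \<alpha>)) * u powr (- 1 - \<beta>))"
      unfolding 2 3 ..
    finally have "c * u powr (?a - 1) * (c * u powr ?a) powr (n + \<alpha> * \<beta> - 1) =
        c powr (n + \<alpha> * \<beta>) * (u powr (- (n / \<alpha>)) * u powr (- 1 - \<beta>))" .
    then show ?thesis
      using pos by (simp add: max_absorb2 field_simps)
  qed
  have "(LBINT s:{0<..}. s powr (n + \<alpha> * \<beta> - 1) * F s) = (LBINT s:{0<..}. ?f s)"
    by (intro set_lebesgue_integral_cong) auto
  also have "\<dots> = (LBINT u:{0<..}. \<bar>?a\<bar> * c * u powr (?a - 1) * ?f (c * u powr ?a))"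
    using pos by (intro powr_substitution(2)[OF f, symmetric]) auto
  also have "\<dots> = (LBINT u:{0<..}. c powr (n + \<alpha> * \<beta>) / \<alpha> * ?g u)"
    by (intro set_lebesgue_integral_cong allI impI eq) auto
  also have "\<dots> = c powr (n + \<alpha> * \<beta>) / \<alpha> * ?I"
    by (rule set_integral_mult_right)
  finally have J: "(LBINT s:{0<..}. s powr (n + \<alpha> * \<beta> - 1) * F s) = c powr (n + \<alpha> * \<beta>) / \<alpha> * ?I" .
  have "c powr (- n - \<alpha> * \<beta>) * c powr (n + \<alpha> * \<beta>) = 1"
    using pos by (simp add: powr_add[symmetric])
  then show "?I = \<alpha> * c powr (- n - \<alpha> * \<beta>) * (LBINT s:{0<..}. s powr (n + \<alpha> * \<beta> - 1) * F s)"
    unfolding J using pos by simp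
  have g_pos: "0 < ?g u" if "0 < u" for u
    using that pos F_pos by simp
  then have "0 \<le> indicator {0<..} u * ?g u" for u
    by (simp add: indicator_def less_imp_le)
  then have nonneg: "AE u in lborel. 0 \<le> indicator {0<..} u * ?g u" by simp
  \<comment> \<open>A nonnegative function with integral 0 vanishes almost everywhere, but this one
    is positive on the unit interval.\<close>
  have "?I \<noteq> 0"
  proof
    assume "?I = 0"
    then have "AE u in lborel. indicator {0<..} u * ?g u = 0"
      using integral_nonneg_eq_0_iff_AE[OF _ nonneg] int
      by (simp add: set_integrable_def set_lebesgue_integral_def)
    then have "AE u in lborel. u \<notin> {0<..<1::real}"
      by eventually_elim (use g_pos in \<open>fastforce simp: indicator_def\<close>)
    then have "emeasure lborel {0<..<1::real} = 0"
      by (subst (asm) AE_iff_measurable[of "{0<..<1}"]) auto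
    then show False by simp
  qed
  moreover have "0 \<le> ?I"
    unfolding set_lebesgue_integral_def using nonneg by (intro integral_nonneg_AE) auto
  ultimately show "0 < ?I" by simp
qed

section \<open>The subordinate density\<close>

text \<open>Replacing \<open>F\<close> by 1 leaves the negative moment of order
  \<open>n / \<alpha>\<close>. The error is at most
  \<open>K * \<delta> * V powr (- (1 / \<alpha>))\<close> under the same weight, whose expectation
  is the moment of order \<open>(n + 1) / \<alpha>\<close>.\<close>

lemma near_diagonal_estimate:
  fixes V :: "'w \<Rightarrow> real" and F :: "real \<Rightarrow> real" and \<beta> n \<alpha> \<delta> K :: real
  assumes M: "prob_space M" and V [measurable]: "V \<in> borel_measurable M"
    and nonneg: "AE \<omega> in M. 0 \<le> V \<omega>"
    and laplace: "\<And>r. 0 < r \<Longrightarrow> (\<integral>\<omega>. exp (- (r * V \<omega>)) \<partial>M) = exp (- (r powr \<beta>))"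
    and pos: "0 < \<beta>" "0 < n" "0 < \<alpha>" "0 \<le> \<delta>"
    and F: "continuous_on {0..} F" and F01: "\<And>r. 0 \<le> r \<Longrightarrow> 0 < F r \<and> F r \<le> 1"
    and lip: "\<And>r. 0 \<le> r \<Longrightarrow> 1 - F r \<le> K * r"
  shows "\<bar>(\<integral>\<omega>. V \<omega> powr (- (n / \<alpha>)) * F (\<delta> * V \<omega> powr (- (1 / \<alpha>))) \<partial>M) - Gamma (n / \<alpha> / \<beta>) / (\<beta> * Gamma (n / \<alpha>))\<bar>
     \<le> K * \<delta> * (Gamma ((n + 1) / \<alpha> / \<beta>) / (\<beta> * Gamma ((n + 1) / \<alpha>)))"
proof -
  have "0 < n / \<alpha>" "0 < (n + 1) / \<alpha>" using pos by simp_all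
  note m1 = negative_moment[OF M V nonneg laplace pos(1) this(1)]
    and m2 = negative_moment[OF M V nonneg laplace pos(1) this(2)]
  let ?F = "\<lambda>\<omega>. F (\<delta> * V \<omega> powr (- (1 / \<alpha>)))"
  have [measurable]: "?F \<in> borel_measurable M"
    using pos by (intro measurable_compose_nonneg[OF F]) auto
  have F01': "0 < ?F \<omega>" "?F \<omega> \<le> 1" for \<omega>
    using F01[of "\<delta> * V \<omega> powr (- (1 / \<alpha>))"] pos by auto
  have int: "integrable M (\<lambda>\<omega>. V \<omega> powr (- (n / \<alpha>)) * ?F \<omega>)"
    using F01' by (intro Bochner_Integration.integrable_bound[OF m1(2)]) (auto simp: abs_mult less_imp_le intro!: mult_left_le)
  have d: "integrable M (\<lambda>\<omega>. V \<omega> powr (- (n / \<alpha>)) * (1 - ?F \<omega>))"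
    using Bochner_Integration.integrable_diff[OF m1(2) int] by (simp add: algebra_simps)
  have le: "V \<omega> powr (- (n / \<alpha>)) * (1 - ?F \<omega>) \<le> K * \<delta> * V \<omega> powr (- ((n + 1) / \<alpha>))" for \<omega>
  proof -
    have "V \<omega> powr (- (n / \<alpha>)) * (1 - ?F \<omega>) \<le> V \<omega> powr (- (n / \<alpha>)) * (K * (\<delta> * V \<omega> powr (- (1 / \<alpha>))))"
      using pos by (intro mult_left_mono lip) auto
    also have "\<dots> = K * \<delta> * (V \<omega> powr (- (n / \<alpha>)) * V \<omega> powr (- (1 / \<alpha>)))"
      by simp
    also have "V \<omega> powr (- (n / \<alpha>)) * V \<omega> powr (- (1 / \<alpha>)) = V \<omega> powr (- ((n + 1) / \<alpha>))"
      by (simp add: powr_add[symmetric] add_divide_distrib)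
    finally show ?thesis .
  qed
  have "(\<integral>\<omega>. V \<omega> powr (- (n / \<alpha>)) * ?F \<omega> \<partial>M) - (\<integral>\<omega>. V \<omega> powr (- (n / \<alpha>)) \<partial>M) =
      - (\<integral>\<omega>. V \<omega> powr (- (n / \<alpha>)) * (1 - ?F \<omega>) \<partial>M)"
    using int m1(2) by (simp add: right_diff_distrib)
  moreover have "0 \<le> (\<integral>\<omega>. V \<omega> powr (- (n / \<alpha>)) * (1 - ?F \<omega>) \<partial>M)"
    using F01' by (intro Bochner_Integration.integral_nonneg mult_nonneg_nonneg) auto
  moreover have "(\<integral>\<omega>. V \<omega> powr (- (n / \<alpha>)) * (1 - ?F \<omega>) \<partial>M) \<le> (\<integral>\<omega>. K * \<delta> * V \<omega> powr (- ((n + 1) / \<alpha>)) \<partial>M)"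
    using m2(2) d le by (intro integral_mono) auto
  moreover have "(\<integral>\<omega>. K * \<delta> * V \<omega> powr (- ((n + 1) / \<alpha>)) \<partial>M) =
      K * \<delta> * (Gamma ((n + 1) / \<alpha> / \<beta>) / (\<beta> * Gamma ((n + 1) / \<alpha>)))"
    using m2(3) by simp
  ultimately show ?thesis
    using m1(3) by linarith
qed

text \<open>Dividing by \<open>c\<close> replaces \<open>r\<close> by \<open>r / c\<close> in the
  Laplace transform, which changes the time \<open>t\<close> into
  \<open>t * c powr (- \<beta>)\<close>. Nonnegativity comes from the monotone paths and the start
  at 0.\<close>

lemma stable_subordinator_scaled:
  fixes S :: "real \<Rightarrow> 'w \<Rightarrow> real"
  assumes S: "stable_subordinator \<beta> P S" and t: "0 < t" and c: "0 < c"
  shows "prob_space P" and "(\<lambda>\<omega>. S t \<omega> / c) \<in> borel_measurable P"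
    and "AE \<omega> in P. 0 \<le> S t \<omega> / c"
    and "0 < r \<Longrightarrow> (\<integral>\<omega>. exp (- (r * (S t \<omega> / c))) \<partial>P) = exp (- (t * c powr (- \<beta>) * r powr \<beta>))"
proof -
  have levy: "levy_process P S"
    and mono: "AE \<omega> in P. \<forall>s t. 0 \<le> s \<and> s \<le> t \<longrightarrow> S s \<omega> \<le> S t \<omega>"
    and laplace: "\<And>r t. 0 < r \<Longrightarrow> 0 \<le> t \<Longrightarrow> (\<integral>\<omega>. exp (- r * S t \<omega>) \<partial>P) = exp (- t * r powr \<beta>)"
    using S by (auto simp: stable_subordinator_def)
  show "prob_space P" using levy by (simp add: levy_process_def)
  have [measurable]: "S t \<in> borel_measurable P"
    using levy t by (simp add: levy_process_def)
  show "(\<lambda>\<omega>. S t \<omega> / c) \<in> borel_measurable P" by measurable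
  have "AE \<omega> in P. S 0 \<omega> = 0" using levy by (simp add: levy_process_def)
  with mono show "AE \<omega> in P. 0 \<le> S t \<omega> / c"
  proof eventually_elim
    case (elim \<omega>)
    then have "0 \<le> S t \<omega>" using t by (metis order_refl less_imp_le)
    with c show ?case by simp
  qed
  show "(\<integral>\<omega>. exp (- (r * (S t \<omega> / c))) \<partial>P) = exp (- (t * c powr (- \<beta>) * r powr \<beta>))" if "0 < r"
    using laplace[of "r / c" t] that c t by (simp add: powr_divide powr_minus_divide)
qed

text \<open>Splitting each power of \<open>S t\<close> into a power of \<open>c\<close> and one of
  \<open>S t / c\<close> leaves \<open>dist x y * c powr (- (1 / \<alpha>))\<close> as the only
  spatial parameter. The scale \<open>c\<close> stays free, since the two regimes choose it
  differently.\<close>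

lemma subordinate_density_scaled:
  fixes P :: "'m::metric_space \<Rightarrow> 'w measure" and F :: "real \<Rightarrow> real"
  assumes S: "stable_subordinator \<beta> (P x) S" and t: "0 < t" and c: "0 < c"
    and pos: "0 < C\<^sub>2" and F: "continuous_on {0..} F"
  shows "subordinate_density P S (profile_density C\<^sub>1 C\<^sub>2 n \<alpha> F) t x y =
    C\<^sub>1 * c powr (- (n / \<alpha>)) * (\<integral>\<omega>. (S t \<omega> / c) powr (- (n / \<alpha>)) *
      F (C\<^sub>2 * (dist x y * c powr (- (1 / \<alpha>))) * (S t \<omega> / c) powr (- (1 / \<alpha>))) \<partial>P x)"
proof -
  note V = stable_subordinator_scaled[OF S t]
  have [measurable]: "S t \<in> borel_measurable (P x)" using V(2)[of 1] by simp
  have [measurable]: "(\<lambda>s. F (C\<^sub>2 * (dist x y / s powr (1 / \<alpha>)))) \<in> borel_measurable borel"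
    using pos by (intro measurable_compose_nonneg[OF F]) auto
  then have [measurable]: "(\<lambda>s. profile_density C\<^sub>1 C\<^sub>2 n \<alpha> F s x y) \<in> borel_measurable borel"
    unfolding profile_density_def by measurable
  have [measurable]: "(\<lambda>\<omega>. F (C\<^sub>2 * (dist x y * c powr (- (1 / \<alpha>))) * (S t \<omega> / c) powr (- (1 / \<alpha>)))) \<in> borel_measurable (P x)"
    using pos by (intro measurable_compose_nonneg[OF F]) auto
  have "subordinate_density P S (profile_density C\<^sub>1 C\<^sub>2 n \<alpha> F) t x y =
      (\<integral>\<omega>. indicator {0<..} (S t \<omega>) * profile_density C\<^sub>1 C\<^sub>2 n \<alpha> F (S t \<omega>) x y \<partial>P x)"
    unfolding subordinate_density_def set_lebesgue_integral_def real_scaleR_def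
    by (rule integral_distr) measurable
  also have "\<dots> = (\<integral>\<omega>. C\<^sub>1 * c powr (- (n / \<alpha>)) * ((S t \<omega> / c) powr (- (n / \<alpha>)) *
      F (C\<^sub>2 * (dist x y * c powr (- (1 / \<alpha>))) * (S t \<omega> / c) powr (- (1 / \<alpha>)))) \<partial>P x)"
  proof (rule integral_cong_AE)
    show "AE \<omega> in P x. indicator {0<..} (S t \<omega>) * profile_density C\<^sub>1 C\<^sub>2 n \<alpha> F (S t \<omega>) x y =
        C\<^sub>1 * c powr (- (n / \<alpha>)) * ((S t \<omega> / c) powr (- (n / \<alpha>)) *
        F (C\<^sub>2 * (dist x y * c powr (- (1 / \<alpha>))) * (S t \<omega> / c) powr (- (1 / \<alpha>))))"
      using V(3)[OF zero_less_one]
    proof eventually_elim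
      case (elim \<omega>)
      have "c powr a * (s / c) powr a = s powr a" if "0 < s" for s a
        using that c by (simp add: powr_divide)
      then have "c powr (- (n / \<alpha>)) * (S t \<omega> / c) powr (- (n / \<alpha>)) = 1 / S t \<omega> powr (n / \<alpha>)"
        "c powr (- (1 / \<alpha>)) * (S t \<omega> / c) powr (- (1 / \<alpha>)) = 1 / S t \<omega> powr (1 / \<alpha>)"
        if "0 < S t \<omega>" using that by (simp_all flip: powr_minus_divide)
      \<comment> \<open>Where \<open>S t \<omega> = 0\<close> both sides are 0: the left by the
        indicator, the right by \<open>0 powr _ = 0\<close>.\<close>
      with elim show ?case
        by (cases "S t \<omega> = 0") (simp_all add: profile_density_def mult.assoc flip: mult.assoc[of "c powr (- (n / \<alpha>))"])
    qed
  qed measurable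
  finally show ?thesis by simp
qed

theorem theorem2p1:
  fixes \<beta> n \<alpha> C\<^sub>1 C\<^sub>2 :: real
    and F :: "real \<Rightarrow> real"
    and N :: "'w measure"
    and P :: "'m::metric_space \<Rightarrow> 'w measure"
    and X :: "real \<Rightarrow> 'w \<Rightarrow> 'm"
    and S :: "real \<Rightarrow> 'w \<Rightarrow> real"
    and \<mu> :: "'m measure"
    and p pS :: "real \<Rightarrow> 'm \<Rightarrow> 'm \<Rightarrow> real"
    and A :: "real \<times> 'm \<times> 'm \<Rightarrow> real"
  defines "p \<equiv> profile_density C\<^sub>1 C\<^sub>2 n \<alpha> F"
    and "pS \<equiv> subordinate_density P S p"
    and "A \<equiv> \<lambda>(t, x, y). dist x y * t powr (- 1 / (\<alpha> * \<beta>))"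
  assumes beta: "0 < \<beta>" "\<beta> < 1"
    and locally_compact: "locally_compact_space (euclidean :: 'm topology)"
    and separable: "separable_space (euclidean :: 'm topology)"
    and feller: "feller_process N P X"
    and subordinator: "\<And>x. stable_subordinator \<beta> (P x) S"
    and independent: "\<And>x. independent_processes (P x) X S"
    and constants: "0 < n" "0 < \<alpha>" "0 < C\<^sub>1" "0 < C\<^sub>2"
    and F_pos: "\<And>r. 0 \<le> r \<Longrightarrow> 0 < F r"
    and F_antimono: "antimono_on {0..} F"
    and F_profile: "exponential_type \<alpha> F \<or> polynomial_type n \<alpha> F"
    and borel_reference: "sets \<mu> = sets borel"
    and density: "transition_density P X \<mu> p"
  shows "(set_integrable lborel {1..} (\<lambda>s. s powr (n + \<alpha> * \<beta> - 1) * F s) \<longrightarrow>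
            (\<lambda>(t, x, y). pS t x y)
              \<sim>[regime A at_top]
            (\<lambda>(t, x, y). C\<^sub>1 * (\<alpha> * \<beta> / Gamma (1 - \<beta>)) * C\<^sub>2 powr (- n - \<alpha> * \<beta>) *
               (LBINT s:{0<..}. s powr (n + \<alpha> * \<beta> - 1) * F s) *
               dist x y powr (- n - \<alpha> * \<beta>) * t)) \<and>
         (\<lambda>(t, x, y). pS t x y)
           \<sim>[regime A (nhds 0)]
         (\<lambda>(t, x, y). C\<^sub>1 * Lim (at_right 0) F *
            (Gamma (n / (\<alpha> * \<beta>)) / (\<beta> * Gamma (n / \<alpha>))) * t powr (- n / (\<alpha> * \<beta>)))"
proof (intro conjI impI)
  obtain K l where F: "continuous_on {0..} F" "\<And>r. 0 \<le> r \<Longrightarrow> 0 < F r \<and> F r \<le> 1"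
      and K: "\<And>r. 0 \<le> r \<Longrightarrow> 1 - F r \<le> K * r"
      and l: "((\<lambda>r. r powr (n + \<alpha>) * F r) \<longlongrightarrow> l) at_top"
    using profile_bounds[OF constants(1) F_profile] by blast
  have pS: "pS t x y = C\<^sub>1 * c powr (- (n / \<alpha>)) * (\<integral>\<omega>. (S t \<omega> / c) powr (- (n / \<alpha>)) *
      F (C\<^sub>2 * (dist x y * c powr (- (1 / \<alpha>))) * (S t \<omega> / c) powr (- (1 / \<alpha>))) \<partial>P x)"
    if "0 < t" "0 < c" for t x y c
    unfolding pS_def p_def by (rule subordinate_density_scaled[OF subordinator that constants(4) F(1)])
  have A_tendsto: "(A \<longlongrightarrow> 0) (regime A (nhds 0))" "filterlim A at_top (regime A at_top)"
    unfolding regime_def by (auto intro: filterlim_mono[OF filterlim_filtercomap])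
  have t_pos: "eventually (\<lambda>i. 0 < fst i) (regime A L)" for L
    unfolding regime_def by (auto simp: eventually_inf_principal intro!: always_eventually)

  \<comment> \<open>Asymptotics far from the diagonal\<close>
  show "(\<lambda>(t, x, y). pS t x y)
      \<sim>[regime A at_top]
    (\<lambda>(t, x, y). C\<^sub>1 * (\<alpha> * \<beta> / Gamma (1 - \<beta>)) * C\<^sub>2 powr (- n - \<alpha> * \<beta>) *
       (LBINT s:{0<..}. s powr (n + \<alpha> * \<beta> - 1) * F s) *
       dist x y powr (- n - \<alpha> * \<beta>) * t)" (is "_ \<sim>[?G] _")
  proof (rule asymp_equivI')
    \<comment> \<open>With this scale \<open>dist x y * c powr (- (1 / \<alpha>)) = 1\<close>, so
      the function \<open>g\<close> of \<open>V\<close> is the same for all triples, and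
      \<open>\<epsilon>\<close> equals \<open>A powr (- (\<alpha> * \<beta>))\<close>, which tends
      to 0.\<close>
    define c where "c = (\<lambda>(t::real, x, y). dist (x::'m) y powr \<alpha>)"
    define \<epsilon> where "\<epsilon> = (\<lambda>i :: real \<times> 'm \<times> 'm. fst i * c i powr (- \<beta>))"
    define V where "V = (\<lambda>(i :: real \<times> 'm \<times> 'm) \<omega>. S (fst i) \<omega> / c i)"
    define M where "M = (\<lambda>i :: real \<times> 'm \<times> 'm. P (fst (snd i)))"
    define g where "g = (\<lambda>u::real. u powr (- (n / \<alpha>)) * F (C\<^sub>2 * u powr (- (1 / \<alpha>))))"
    define k where "k = (\<lambda>u. g u / (1 - exp (- u)))"
    have k: "k \<in> borel_measurable borel" "continuous_on {0<..} k"
        "(k \<longlongrightarrow> C\<^sub>2 powr (- (n + \<alpha>)) * l) (at_right 0)" "(k \<longlongrightarrow> 0) at_top"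
      unfolding k_def g_def using profile_quotient_limits[OF constants(1,2,4) F l] by blast+
    \<comment> \<open>This includes \<open>u = 0\<close>, where \<open>0 powr _ = 0\<close> gives
      \<open>g 0 = 0\<close>.\<close>
    have gk: "(1 - exp (- u)) * k u = g u" for u
      by (cases "u = 0") (auto simp: k_def g_def)
    \<comment> \<open>In this regime \<open>A\<close> is eventually positive, which forces
      \<open>x\<close> and \<open>y\<close> to be distinct and the scale \<open>c\<close> to be
      positive.\<close>
    have dist_pos: "eventually (\<lambda>i. 0 < fst i \<and> 0 < dist (fst (snd i)) (snd (snd i))) ?G"
      using A_tendsto(2)[unfolded filterlim_at_top_dense, rule_format, of 0] t_pos
      by eventually_elim (auto simp: A_def zero_less_mult_iff)
    have fam: "eventually (\<lambda>i. prob_space (M i) \<and> V i \<in> borel_measurable (M i) \<and> (AE \<omega> in M i. 0 \<le> V i \<omega>) \<and>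
        0 < \<epsilon> i \<and> (\<forall>r>0. (\<integral>\<omega>. exp (- (r * V i \<omega>)) \<partial>M i) = exp (- (\<epsilon> i * r powr \<beta>)))) ?G"
      using dist_pos
    proof eventually_elim
      case (elim i)
      then have t: "0 < fst i" and c: "0 < c i" by (auto simp: c_def split: prod.splits)
      note stable_subordinator_scaled[OF subordinator t c]
      with t c show ?case unfolding M_def V_def \<epsilon>_def by auto
    qed
    have "((\<lambda>a. a powr (- (\<alpha> * \<beta>))) \<longlongrightarrow> 0) at_top"
      using constants beta by real_asymp
    from filterlim_compose[OF this A_tendsto(2)]
    have "((\<lambda>i. A i powr (- (\<alpha> * \<beta>))) \<longlongrightarrow> 0) ?G" .
    moreover have "eventually (\<lambda>i. A i powr (- (\<alpha> * \<beta>)) = \<epsilon> i) ?G"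
      using dist_pos
    proof eventually_elim
      case (elim i)
      then show ?case
        using constants beta
        by (auto simp: A_def \<epsilon>_def c_def powr_mult powr_powr split: prod.splits)
    qed
    ultimately have \<epsilon>: "(\<epsilon> \<longlongrightarrow> 0) ?G" by (rule Lim_transform_eventually)
    define J where "J = (LBINT u:{0<..}. g u * u powr (- 1 - \<beta>))"
    note small = small_time_limit[OF beta fam \<epsilon> k, unfolded gk]
    have J: "J = \<alpha> * C\<^sub>2 powr (- n - \<alpha> * \<beta>) * (LBINT s:{0<..}. s powr (n + \<alpha> * \<beta> - 1) * F s)" "0 < J"
      using profile_levy_integral[OF constants(1,2,4) beta(1) F(1) F_pos] small(1)
      unfolding J_def g_def by blast+
    have J_const: "0 < \<beta> / Gamma (1 - \<beta>) * J"
      using J(2) beta by (simp add: Gamma_real_pos)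
    have "((\<lambda>i. (\<integral>\<omega>. g (V i \<omega>) \<partial>M i) / \<epsilon> i / (\<beta> / Gamma (1 - \<beta>) * J)) \<longlongrightarrow>
        (\<beta> / Gamma (1 - \<beta>) * J) / (\<beta> / Gamma (1 - \<beta>) * J)) ?G"
      using small(2) J_const unfolding J_def by (intro tendsto_divide) auto
    then have "((\<lambda>i. (\<integral>\<omega>. g (V i \<omega>) \<partial>M i) / \<epsilon> i / (\<beta> / Gamma (1 - \<beta>) * J)) \<longlongrightarrow> 1) ?G"
      unfolding divide_self[OF J_const[THEN less_imp_neq, THEN not_sym]] .
    moreover have "eventually (\<lambda>i. (\<integral>\<omega>. g (V i \<omega>) \<partial>M i) / \<epsilon> i / (\<beta> / Gamma (1 - \<beta>) * J) =
        (case i of (t, x, y) \<Rightarrow> pS t x y) / (case i of (t, x, y) \<Rightarrow>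
          C\<^sub>1 * (\<alpha> * \<beta> / Gamma (1 - \<beta>)) * C\<^sub>2 powr (- n - \<alpha> * \<beta>) *
          (LBINT s:{0<..}. s powr (n + \<alpha> * \<beta> - 1) * F s) * dist x y powr (- n - \<alpha> * \<beta>) * t)) ?G"
      using dist_pos
    proof eventually_elim
      case (elim i)
      obtain t x y where i: "i = (t, x, y)" by (cases i)
      with elim have t: "0 < t" and \<rho>: "0 < dist x y" by auto
      let ?\<rho> = "dist x y" and ?E = "\<integral>\<omega>. g (V i \<omega>) \<partial>M i"
      have \<rho>\<alpha>: "(?\<rho> powr \<alpha>) powr (- (1 / \<alpha>)) = 1 / ?\<rho>" "(?\<rho> powr \<alpha>) powr (- (n / \<alpha>)) = ?\<rho> powr (- n)"
        using \<rho> constants by (simp_all add: powr_powr powr_minus_divide)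
      have num: "pS t x y = C\<^sub>1 * ?\<rho> powr (- n) * ?E"
        using \<rho> by (subst pS[OF t, of "?\<rho> powr \<alpha>"]) (simp_all add: \<rho>\<alpha> g_def V_def M_def c_def i)
      have den: "C\<^sub>1 * (\<alpha> * \<beta> / Gamma (1 - \<beta>)) * C\<^sub>2 powr (- n - \<alpha> * \<beta>) *
          (LBINT s:{0<..}. s powr (n + \<alpha> * \<beta> - 1) * F s) * ?\<rho> powr (- n - \<alpha> * \<beta>) * t =
          (C\<^sub>1 * ?\<rho> powr (- n)) * (\<epsilon> i * (\<beta> / Gamma (1 - \<beta>) * J))"
      proof -
        have "?\<rho> powr (- n - \<alpha> * \<beta>) * t = ?\<rho> powr (- n) * \<epsilon> i"
          using \<rho> by (simp add: \<epsilon>_def c_def i powr_powr powr_diff powr_minus divide_inverse)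
        then show ?thesis unfolding J(1) by (simp add: mult_ac)
      qed
      have "C\<^sub>1 * ?\<rho> powr (- n) \<noteq> 0" using \<rho> constants by simp
      then show ?case
        unfolding i prod.case num[unfolded i] den[unfolded i]
        by (simp only: mult_divide_mult_cancel_left_if divide_divide_eq_left if_False)
    qed
    ultimately show "((\<lambda>i. (case i of (t, x, y) \<Rightarrow> pS t x y) / (case i of (t, x, y) \<Rightarrow>
          C\<^sub>1 * (\<alpha> * \<beta> / Gamma (1 - \<beta>)) * C\<^sub>2 powr (- n - \<alpha> * \<beta>) *
          (LBINT s:{0<..}. s powr (n + \<alpha> * \<beta> - 1) * F s) * dist x y powr (- n - \<alpha> * \<beta>) * t)) \<longlongrightarrow> 1) ?G"
      by (rule Lim_transform_eventually)
  qed

  \<comment> \<open>Asymptotics close to the diagonal\<close>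
  show "(\<lambda>(t, x, y). pS t x y)
      \<sim>[regime A (nhds 0)]
    (\<lambda>(t, x, y). C\<^sub>1 * Lim (at_right 0) F *
       (Gamma (n / (\<alpha> * \<beta>)) / (\<beta> * Gamma (n / \<alpha>))) * t powr (- n / (\<alpha> * \<beta>)))" (is "_ \<sim>[?G] _")
  proof (rule asymp_equivI')
    \<comment> \<open>The linear bound on \<open>1 - F r\<close> squeezes \<open>F\<close> to 1 at
      the origin, so the constant \<open>F(0+)\<close> is 1 for both profile types.\<close>
    have "((\<lambda>r. K * r) \<longlongrightarrow> K * 0) (at_right 0)"
      by (intro tendsto_intros)
    then have "((\<lambda>r. K * r) \<longlongrightarrow> 0) (at_right 0)" by simp
    moreover have "eventually (\<lambda>r. norm (F r - 1) \<le> K * r) (at_right 0)"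
      using eventually_at_right_less[of 0]
    proof eventually_elim
      case (elim r)
      then show ?case using F(2)[of r] K[of r] by simp
    qed
    ultimately have "((\<lambda>r. F r - 1) \<longlongrightarrow> 0) (at_right 0)"
      by (rule Lim_null_comparison[rotated])
    then have "(F \<longlongrightarrow> 1) (at_right 0)" by (simp add: LIM_zero_iff)
    then have Lim: "Lim (at_right 0) F = 1" by (intro tendsto_Lim) auto
    define m where "m = Gamma (n / (\<alpha> * \<beta>)) / (\<beta> * Gamma (n / \<alpha>))"
    have m: "0 < m" using constants beta by (simp add: m_def Gamma_real_pos)
    define B where "B = Gamma ((n + 1) / \<alpha> / \<beta>) / (\<beta> * Gamma ((n + 1) / \<alpha>))"
    define E where "E = (\<lambda>(t, x, y). pS t x y / (C\<^sub>1 * t powr (- n / (\<alpha> * \<beta>))))"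
    \<comment> \<open>The bound depends on the triple only through \<open>A\<close>, which gives the
      uniformity that the regime demands.\<close>
    have "eventually (\<lambda>i. norm (E i - m) \<le> K * (C\<^sub>2 * A i) * B) ?G"
      using t_pos
    proof eventually_elim
      case (elim i)
      obtain t x y where i: "i = (t, x, y)" by (cases i)
      with elim have t: "0 < t" by simp
      \<comment> \<open>This scale normalises the Laplace exponent, as
        \<open>t * ?c powr (- \<beta>) = 1\<close>, and turns
        \<open>dist x y * ?c powr (- (1 / \<alpha>))\<close> into \<open>A i\<close>.\<close>
      let ?c = "t powr (1 / \<beta>)"
      have c: "0 < ?c" using t by simp
      note V = stable_subordinator_scaled[OF subordinator t c]
      have laplace: "(\<integral>\<omega>. exp (- (r * (S t \<omega> / ?c))) \<partial>P x) = exp (- (r powr \<beta>))" if "0 < r" for r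
        using V(4)[OF that] t beta by (simp add: powr_powr powr_minus)
      have A: "0 \<le> C\<^sub>2 * A i" using constants by (simp add: A_def i)
      have "?c powr (- (1 / \<alpha>)) = t powr (- 1 / (\<alpha> * \<beta>))" "?c powr (- (n / \<alpha>)) = t powr (- n / (\<alpha> * \<beta>))"
        by (simp_all add: powr_powr mult.commute)
      then have "E i = (\<integral>\<omega>. (S t \<omega> / ?c) powr (- (n / \<alpha>)) * F (C\<^sub>2 * A i * (S t \<omega> / ?c) powr (- (1 / \<alpha>))) \<partial>P x)"
        using t constants unfolding E_def i prod.case by (subst pS[OF t c]) (simp add: A_def)
      then show ?case
        using near_diagonal_estimate[OF V(1-3) laplace beta(1) constants(1,2) A F K]
        by (simp add: m_def B_def)
    qed
    moreover have "((\<lambda>i. K * (C\<^sub>2 * A i) * B) \<longlongrightarrow> K * (C\<^sub>2 * 0) * B) ?G"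
      by (intro tendsto_intros A_tendsto)
    ultimately have "((\<lambda>i. E i - m) \<longlongrightarrow> 0) ?G"
      using Lim_null_comparison[of "\<lambda>i. E i - m"] by simp
    then have "(E \<longlongrightarrow> m) ?G" by (simp add: LIM_zero_iff)
    then have "((\<lambda>i. E i / m) \<longlongrightarrow> m / m) ?G"
      using m by (intro tendsto_intros) auto
    then show "((\<lambda>i. (case i of (t, x, y) \<Rightarrow> pS t x y) / (case i of (t, x, y) \<Rightarrow>
        C\<^sub>1 * Lim (at_right 0) F * (Gamma (n / (\<alpha> * \<beta>)) / (\<beta> * Gamma (n / \<alpha>))) * t powr (- n / (\<alpha> * \<beta>)))) \<longlongrightarrow> 1) ?G"
      using m unfolding Lim m_def[symmetric]
      by (simp add: E_def case_prod_unfold mult_ac)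
  qed
qed

end
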